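(* The Euclidean algorithm $\mathcal{E}:\mathbb{R}^2_+\to\mathbb{R}^2_+$, defined by $$\mathcal{E}(\lambda_1,\lambda_2)=\begin{cases}(\lambda_1-\lambda_2,\lambda_2) & \text{if } \lambda_1\geq\lambda_2,\\ (\lambda_1,\lambda_2-\lambda_1) & \text{if } \lambda_1<\lambda_2,\end{cases}$$ is exact with respect to Lebesgue measure on $\mathbb{R}^2_+$.
   Context: $\mathbb{R}^2_+=\{(\lambda_1,\lambda_2)\in\mathbb{R}^2:\lambda_1\geq 0,\lambda_2\geq 0\}$, with its Borel $\sigma$-algebra and Lebesgue measure. A measurable map $\mathcal{T}:X\to X$ of a measure space $(X,\mathcal{B},\mu)$ is called exact (with respect to $\mu$) if every $\Omega\in\bigcap_{m\geq 1}\mathcal{T}^{-m}(\mathcal{B})$ satisfies $\mu(\Omega)=0$ or $\mu(X\setminus\Omega)=0$, where $\mathcal{T}^{-m}(\mathcal{B})=\{\mathcal{T}^{-m}(A):A\in\mathcal{B}\}$. *)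

theory Defs
  imports "HOL-Analysis.Analysis"
begin

definition exact_map :: "'a measure \<Rightarrow> ('a \<Rightarrow> 'a) \<Rightarrow> bool" where
  "exact_map M T \<longleftrightarrow>
     T \<in> measurable M M \<and>
     (\<forall>\<Omega> \<in> (\<Inter>m\<in>{1::nat..}. {(T ^^ m) -` A \<inter> space M | A. A \<in> sets M}).
        emeasure M \<Omega> = 0 \<or> emeasure M (space M - \<Omega>) = 0)"

definition quadrant :: "(real \<times> real) set" where
  "quadrant = {(x, y). 0 \<le> x \<and> 0 \<le> y}"

(* lborel is Lebesgue measure on the Borel sets (not its completion). *)
definition quadrant_measure :: "(real \<times> real) measure" where
  "quadrant_measure = restrict_space lborel quadrant"

(* A total function on the plane; only its values on the quadrant matter, since exactness
   on quadrant_measure intersects all preimages with the quadrant. *)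
definition euclid_alg :: "real \<times> real \<Rightarrow> real \<times> real" where
  "euclid_alg = (\<lambda>(x, y). if x \<ge> y then (x - y, y) else (x, y - x))"

end

(* Write A, B for the two inverse branches (x, y) -> (x + y, y), (x, x + y) of the algorithm E on the
open quadrant. A set S in the tail sigma-algebra satisfies 1_S (W x) = 1_S (W' x) for all words W, W'
in A, B of the same length, hence 1_S (W x) = 1_T (W A x) with T = E^-1 S.

On the narrow cone W(quadrant) an L1-approximation of 1_S, 1_T by continuous functions depends almost
only on the norm |v| = v1 + v2, say 1_S ~ phi(|v|) and 1_T ~ Phi(|v|). If q1, q2 are the column sums
of W, the relation becomes phi(q1 s + q2 t) ~ Phi(q1 s + (q1 + q2) t); as these two linear forms are
independent, phi and Phi are nearly equal to one common constant, uniformly over all cones with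
1/2 <= q1/q2 <= 2. These cones exhaust the quadrant up to a null set, at arbitrarily fine scales, so
S = T and S is invariant under all dilations, almost everywhere. Then S = W^-1 S up to null sets, so
knowing that S is nearly trivial on a single cone W(quadrant) shows that S itself is nearly trivial
on a fixed triangle. *)

theory Submission
  imports Defs
begin

section \<open>Linear changes of variables in the plane\<close>

text \<open>No covering or density theorem is used to reach the good cones. All approximation errors
  are gathered into a function X >= 0, and for a set Y of positive finite measure the function Z =
  \<theta>/200 * 1_Y - X has positive integral once the approximation is fine enough. A cone is
  tiled by its two subcones, so positivity of the integral can be handed down to ever narrower
  cones; where it survives, the error is a small fraction of the mass of Y in that cone. With Y a
  hypothetical set of bad points this yields a contradiction, with Y a fixed annulus it yields the
  single cone of the last step. That is all that remains of the exhaustion claim.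

  The obstacle is long blocks of one letter: if q1/q2 is near 0 the two linear forms nearly
  coincide, and if it is huge the second leaves every fixed annulus. So the descent must be forced
  to change letter, with 1/2 and 2 as the resulting bounds on the ratio.

  A pair (S, T) is needed because W and W A have different lengths, while the tail property compares
  only words of equal length.\<close>

abbreviation plane :: "(real \<times> real) measure" where
  "plane \<equiv> lborel \<Otimes>\<^sub>M lborel"

lemma nn_integral_plane_fst:
  assumes "h \<in> borel_measurable plane"
  shows "(\<integral>\<^sup>+v. h v \<partial>plane) = (\<integral>\<^sup>+x. \<integral>\<^sup>+y. h (x, y) \<partial>lborel \<partial>lborel)"
  using lborel.nn_integral_fst[OF assms] by simp

lemma nn_integral_plane_snd:
  assumes "h \<in> borel_measurable plane"
  shows "(\<integral>\<^sup>+v. h v \<partial>plane) = (\<integral>\<^sup>+y. \<integral>\<^sup>+x. h (x, y) \<partial>lborel \<partial>lborel)"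
  using lborel_pair.nn_integral_snd[OF assms] by simp

lemma nn_integral_shear:
  assumes [measurable]: "h \<in> borel_measurable plane"
  shows "(\<integral>\<^sup>+v. h (fst v + k * snd v, snd v) \<partial>plane) = (\<integral>\<^sup>+v. h v \<partial>plane)"
proof -
  have "(\<integral>\<^sup>+x. h (x, y) \<partial>lborel) = (\<integral>\<^sup>+x. h (x + k * y, y) \<partial>lborel)" for y
    using nn_integral_real_affine[of "\<lambda>x. h (x, y)" 1 "k * y"] by (simp add: add.commute)
  then show ?thesis
    by (simp add: nn_integral_plane_snd)
qed

lemma nn_integral_swap:
  assumes [measurable]: "h \<in> borel_measurable plane"
  shows "(\<integral>\<^sup>+v. h (snd v, fst v) \<partial>plane) = (\<integral>\<^sup>+v. h v \<partial>plane)"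
  using nn_integral_plane_snd[of "\<lambda>v. h (snd v, fst v)"] nn_integral_plane_fst[of h] by simp

lemma nn_integral_diagonal_scaling:
  assumes [measurable]: "h \<in> borel_measurable plane" and "a > 0" "b > 0"
  shows "(\<integral>\<^sup>+v. h v \<partial>plane) = ennreal (a * b) * (\<integral>\<^sup>+v. h (a * fst v, b * snd v) \<partial>plane)"
proof -
  have x: "(\<integral>\<^sup>+x. h (x, y) \<partial>lborel) = ennreal a * (\<integral>\<^sup>+x. h (a * x, y) \<partial>lborel)" for y
    using \<open>a > 0\<close> nn_integral_real_affine[of "\<lambda>x. h (x, y)" a 0] by simp
  have y: "(\<integral>\<^sup>+y. \<integral>\<^sup>+x. h (a * x, y) \<partial>lborel \<partial>lborel)
      = ennreal b * (\<integral>\<^sup>+y. \<integral>\<^sup>+x. h (a * x, b * y) \<partial>lborel \<partial>lborel)"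
    using \<open>b > 0\<close> nn_integral_real_affine[of "\<lambda>y. \<integral>\<^sup>+x. h (a * x, y) \<partial>lborel" b 0] by simp
  have "(\<integral>\<^sup>+v. h v \<partial>plane)
      = ennreal a * (ennreal b * (\<integral>\<^sup>+y. \<integral>\<^sup>+x. h (a * x, b * y) \<partial>lborel \<partial>lborel))"
    unfolding nn_integral_plane_snd[OF assms(1)] y[symmetric] by (simp add: x nn_integral_cmult)
  then show ?thesis
    using assms by (simp add: nn_integral_plane_snd ennreal_mult mult_ac)
qed

section \<open>The open quadrant and the two inverse branches of the algorithm\<close>

definition quad :: "(real \<times> real) set" where
  "quad = {v. 0 < fst v \<and> 0 < snd v}"

lemma quad_pred [measurable]: "Measurable.pred plane (\<lambda>v. v \<in> quad)"
  unfolding quad_def mem_Collect_eq by measurable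

definition letter :: "bool \<Rightarrow> real \<times> real \<Rightarrow> real \<times> real" where
  "letter b v = (if b then (fst v + snd v, snd v) else (fst v, fst v + snd v))"

text \<open>The head of the list is the outermost letter:
  \<open>word (w @ u) v = word w (word u v)\<close>. Appending on the right therefore passes to a
  subcone, while \<open>euclid_alg\<close> strips letters from the left.\<close>

abbreviation word :: "bool list \<Rightarrow> real \<times> real \<Rightarrow> real \<times> real" where
  "word \<equiv> foldr letter"

lemma letter_measurable [measurable]: "letter b \<in> measurable plane plane"
  unfolding letter_def by measurable

lemma word_measurable [measurable]: "word w \<in> measurable plane plane"
proof (induction w)
  case Nil
  have "word [] = (\<lambda>x. x)" by auto
  then show ?case by simp
next
  case (Cons b w)
  have "word (b # w) = letter b \<circ> word w" by auto
  then show ?case using Cons by (metis letter_measurable measurable_comp)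
qed

lemma letter_quad: "v \<in> quad \<Longrightarrow> letter b v \<in> quad"
  by (auto simp: quad_def letter_def)

lemma word_quad: "v \<in> quad \<Longrightarrow> word w v \<in> quad"
  by (induction w) (auto simp: letter_quad)

lemma nn_integral_letter:
  assumes [measurable]: "h \<in> borel_measurable plane"
  shows "(\<integral>\<^sup>+v. h (letter b v) \<partial>plane) = (\<integral>\<^sup>+v. h v \<partial>plane)"
proof (cases b)
  case True
  then show ?thesis using nn_integral_shear[of h 1] by (simp add: letter_def)
next
  case False
  have "(\<integral>\<^sup>+v. h (letter b v) \<partial>plane) = (\<integral>\<^sup>+v. h (snd v, fst v + snd v) \<partial>plane)"
    using False nn_integral_swap[of "\<lambda>v. h (fst v, fst v + snd v)"]
    by (simp add: letter_def add.commute)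
  also have "\<dots> = (\<integral>\<^sup>+v. h (snd v, fst v) \<partial>plane)"
    using nn_integral_shear[of "\<lambda>v. h (snd v, fst v)" 1] by simp
  finally show ?thesis by (simp add: nn_integral_swap)
qed

lemma nn_integral_word:
  assumes "h \<in> borel_measurable plane"
  shows "(\<integral>\<^sup>+v. h (word w v) \<partial>plane) = (\<integral>\<^sup>+v. h v \<partial>plane)"
  using assms
proof (induction w arbitrary: h)
  case (Cons b w)
  then have [measurable]: "h \<in> borel_measurable plane" by simp
  have "(\<lambda>v. h (letter b v)) \<in> borel_measurable plane" by measurable
  from Cons.IH[OF this] show ?case by (simp add: nn_integral_letter)
qed simp

lemma distr_planeI:
  assumes [measurable]: "f \<in> measurable plane plane"
    and *: "\<And>h. h \<in> borel_measurable plane \<Longrightarrow> (\<integral>\<^sup>+v. h (f v) \<partial>plane) = (\<integral>\<^sup>+v. h v \<partial>plane)"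
  shows "distr plane plane f = plane"
proof (rule measure_eqI)
  fix A assume "A \<in> sets (distr plane plane f)"
  then have A [measurable]: "A \<in> sets plane" by simp
  have "emeasure (distr plane plane f) A = (\<integral>\<^sup>+v. indicator A v \<partial>distr plane plane f)"
    using A by (intro nn_integral_indicator[symmetric]) simp
  also have "\<dots> = (\<integral>\<^sup>+v. indicator A (f v) \<partial>plane)"
    by (rule nn_integral_distr) auto
  also have "\<dots> = emeasure plane A"
    unfolding *[OF borel_measurable_indicator[OF A]] by (rule nn_integral_indicator[OF A])
  finally show "emeasure (distr plane plane f) A = emeasure plane A" .
qed simp

lemma distr_word: "distr plane plane (word w) = plane"
  by (intro distr_planeI nn_integral_word word_measurable)

lemma AE_distr_plane:
  assumes "distr plane plane f = plane" "f \<in> measurable plane plane" "AE v in plane. P v"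
  shows "AE v in plane. P (f v)"
proof -
  have "AE v in distr plane plane f. P v" unfolding assms(1) by (rule assms(3))
  then show ?thesis by (rule AE_distrD[OF assms(2)])
qed

section \<open>Balanced words\<close>

lemma AE_plane_offdiagonal: "AE v in plane. fst v \<noteq> snd v"
proof (rule lborel_pair.AE_pair_measure)
  show "AE x in lborel. AE y in lborel. fst (x :: real, y :: real) \<noteq> snd (x, y)"
  proof (rule AE_I2)
    fix x :: real
    show "AE y in lborel. fst (x, y) \<noteq> snd (x, y)"
      using AE_lborel_singleton[of x] by eventually_elim auto
  qed
qed measurable

text \<open>The letter has Jacobian 1 and maps \<open>quad\<close> onto its part on one side of the
  diagonal. The condition is phrased so that the cases \<open>b\<close> and \<open>\<not> b\<close>
  are complementary; the diagonal thereby falls to \<open>False\<close>, which is harmless as it is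
  null.\<close>

lemma integral_letter:
  fixes Z :: "real \<times> real \<Rightarrow> real"
  assumes [measurable]: "Z \<in> borel_measurable plane"
  shows "(\<integral>v. indicator quad v * Z (letter b v) \<partial>plane)
    = (\<integral>v. indicator quad v * (if snd v < fst v \<longleftrightarrow> b then Z v else 0) \<partial>plane)"
proof -
  let ?g = "\<lambda>v. indicator {v. v \<in> quad \<and> (if b then snd v < fst v else fst v < snd v)} v * Z v"
  have [measurable]: "?g \<in> borel_measurable plane"
    by (cases b) (simp_all add: indicator_def)
  have "(\<integral>v. indicator quad v * Z (letter b v) \<partial>plane) = (\<integral>v. ?g (word [b] v) \<partial>plane)"
    by (intro Bochner_Integration.integral_cong) (auto simp: indicator_def quad_def letter_def)
  also have "\<dots> = (\<integral>v. ?g v \<partial>distr plane plane (word [b]))"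
    by (rule integral_distr[symmetric]) measurable
  also have "\<dots> = (\<integral>v. ?g v \<partial>plane)"
    by (subst distr_word) simp
  also have "\<dots> = (\<integral>v. indicator quad v * (if snd v < fst v \<longleftrightarrow> b then Z v else 0) \<partial>plane)"
    by (rule integral_cong_AE)
      (use AE_plane_offdiagonal in \<open>auto simp: indicator_def elim!: eventually_mono split: if_splits\<close>)
  finally show ?thesis .
qed

lemma integrable_word:
  fixes Z :: "real \<times> real \<Rightarrow> real"
  assumes "integrable plane Z"
  shows "integrable plane (\<lambda>v. Z (word w v))"
proof -
  have "integrable (distr plane plane (word w)) Z"
    unfolding distr_word by (rule assms)
  then show ?thesis by (rule integrable_distr[OF word_measurable])
qed

lemma integrable_quad:
  fixes Z :: "real \<times> real \<Rightarrow> real"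
  assumes "integrable plane Z"
  shows "integrable plane (\<lambda>v. indicator quad v * Z v)"
proof -
  have [measurable]: "Z \<in> borel_measurable plane" using assms by simp
  show ?thesis
    by (rule Bochner_Integration.integrable_bound[OF assms]) (measurable, auto simp: indicator_def)
qed

text \<open>The images of \<open>quad\<close> under the two letters tile \<open>quad\<close> up to
  the diagonal. Applied to the composition of \<open>Z\<close> with \<open>word w\<close>, this
  splits the integral over a cone into those over its two subcones.\<close>

lemma integral_letter_split:
  fixes Z :: "real \<times> real \<Rightarrow> real"
  assumes Z: "integrable plane Z"
  shows "(\<integral>v. indicator quad v * Z v \<partial>plane)
    = (\<integral>v. indicator quad v * Z (letter b v) \<partial>plane) + (\<integral>v. indicator quad v * Z (letter (\<not> b) v) \<partial>plane)"
proof -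
  have [measurable]: "Z \<in> borel_measurable plane" using Z by simp
  have "integrable plane (\<lambda>v. indicator quad v * (if snd v < fst v \<longleftrightarrow> b then Z v else 0))" for b
    by (rule Bochner_Integration.integrable_bound[OF Z]) (auto simp: indicator_def)
  from Bochner_Integration.integral_add[OF this[of b] this[of "\<not> b"]] show ?thesis
    unfolding integral_letter[OF \<open>Z \<in> borel_measurable plane\<close>]
    by (subst Bochner_Integration.integral_cong[OF refl]) (auto simp: indicator_def)
qed

section \<open>Blocks of one letter\<close>

lemma letter_simps:
  "letter True v = (fst v + snd v, snd v)"
  "letter False v = (fst v, fst v + snd v)"
  by (simp_all add: letter_def)

lemma letter_power:
  "(letter True ^^ k) v = (fst v + real k * snd v, snd v)"
  "(letter False ^^ k) v = (fst v, snd v + real k * fst v)"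
  by (induction k) (auto simp: letter_def algebra_simps)

text \<open>The cone of the block is the part of \<open>quad\<close> where one coordinate exceeds
  \<open>k\<close> times the other. No point lies in these cones for all \<open>k\<close>, so
  dominated convergence with majorant \<open>\<bar>Z v\<bar>\<close> applies.\<close>

lemma integral_replicate_tendsto_0:
  fixes Z :: "real \<times> real \<Rightarrow> real"
  assumes Z: "integrable plane Z"
  shows "(\<lambda>k. \<integral>v. indicator quad v * Z (word (replicate k b) v) \<partial>plane) \<longlonglongrightarrow> 0"
proof -
  have [measurable]: "Z \<in> borel_measurable plane" using Z by simp
  let ?P = "\<lambda>k v. v \<in> quad \<and> (if b then real k * snd v < fst v else real k * fst v < snd v)"
  let ?g = "\<lambda>k v. if ?P k v then Z v else 0"
  have [measurable]: "?g k \<in> borel_measurable plane" for k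
    by (cases b) simp_all
  have "(\<integral>v. indicator quad v * Z (word (replicate k b) v) \<partial>plane) = (\<integral>v. ?g k v \<partial>plane)" for k
  proof -
    have "(\<integral>v. indicator quad v * Z (word (replicate k b) v) \<partial>plane)
        = (\<integral>v. ?g k (word (replicate k b) v) \<partial>plane)"
      by (intro Bochner_Integration.integral_cong; cases b)
        (auto simp: letter_power quad_def indicator_def add_pos_nonneg)
    also have "\<dots> = (\<integral>v. ?g k v \<partial>distr plane plane (word (replicate k b)))"
      by (rule integral_distr[symmetric]) measurable
    finally show ?thesis unfolding distr_word .
  qed
  moreover have "(\<lambda>k. \<integral>v. ?g k v \<partial>plane) \<longlonglongrightarrow> (\<integral>v. 0 \<partial>plane)"
  proof (rule integral_dominated_convergence[where w="\<lambda>v. \<bar>Z v\<bar>"])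
    show "AE v in plane. (\<lambda>k. ?g k v) \<longlonglongrightarrow> 0"
    proof (intro AE_I2)
      fix v :: "real \<times> real"
      have "\<exists>k0. \<forall>k\<ge>k0. \<not> ?P k v"
      proof (cases "v \<in> quad")
        case True
        define x y where "x = (if b then snd v else fst v)" and "y = (if b then fst v else snd v)"
        have "x > 0" using True by (auto simp: x_def quad_def)
        then obtain k0 where k0: "y < real k0 * x" using ex_less_of_nat_mult by blast
        have "\<not> real k * x < y" if "k \<ge> k0" for k
        proof -
          have "real k0 * x \<le> real k * x" using that \<open>x > 0\<close> by simp
          then show ?thesis using k0 by linarith
        qed
        then show ?thesis by (intro exI[of _ k0]) (auto simp: x_def y_def split: if_splits)
      qed simp
      then have "eventually (\<lambda>k. ?g k v = 0) sequentially"
        unfolding eventually_sequentially by metis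
      then show "(\<lambda>k. ?g k v) \<longlonglongrightarrow> 0" by (rule tendsto_eventually)
    qed
  qed (use Z in \<open>auto\<close>)
  ultimately show ?thesis by simp
qed

text \<open>If no word \<open>b\<^sup>k \<not>b\<close> worked, the integrals over the cones of \<open>b\<^sup>k\<close> would be nondecreasing in \<open>k\<close>;
  but they tend to 0 because these cones shrink to a ray.\<close>

lemma exists_block_integral_pos:
  fixes Z :: "real \<times> real \<Rightarrow> real"
  assumes Z: "integrable plane Z" and pos: "(\<integral>v. indicator quad v * Z v \<partial>plane) > 0"
  shows "\<exists>k. (\<integral>v. indicator quad v * Z (word (replicate k b @ [\<not> b]) v) \<partial>plane) > 0"
proof (rule ccontr)
  define D where "D k = (\<integral>v. indicator quad v * Z (word (replicate k b) v) \<partial>plane)" for k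
  assume "\<not> ?thesis"
  then have *: "(\<integral>v. indicator quad v * Z (word (replicate k b) (letter (\<not> b) v)) \<partial>plane) \<le> 0" for k
    by (simp add: not_less)
  have "D k \<le> D (Suc k)" for k
  proof -
    have "word (replicate (Suc k) b) v = word (replicate k b) (letter b v)" for v
      by (simp add: funpow_swap1)
    then show ?thesis
      using integral_letter_split[OF integrable_word[OF Z, of "replicate k b"], of b] *[of k]
      unfolding D_def by simp
  qed
  then have "D 0 \<le> D k" for k by (induction k) (auto intro: order_trans)
  moreover have "D \<longlonglongrightarrow> 0" unfolding D_def by (rule integral_replicate_tendsto_0[OF Z])
  ultimately have "D 0 \<le> 0" using LIMSEQ_le_const by blast
  then show False using pos by (simp add: D_def)
qed

text \<open>The 1-norms of the images of the two basis vectors, that is, the column sums q1, q2 of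
  the matrix of \<open>w\<close>, read off from \<open>word\<close> without introducing a
  matrix.\<close>

definition col1 :: "bool list \<Rightarrow> real" where
  "col1 w = fst (word w (1, 0)) + snd (word w (1, 0))"

definition col2 :: "bool list \<Rightarrow> real" where
  "col2 w = fst (word w (0, 1)) + snd (word w (0, 1))"

text \<open>Each new outer letter adds one row to the other, which keeps the entries nonnegative and
  the determinant equal to 1.\<close>

lemma word_matrix:
  "\<exists>a b c d. 0 \<le> a \<and> 0 \<le> b \<and> 0 \<le> c \<and> 0 \<le> d \<and> a * d - b * c = 1 \<and>
     col1 w = a + c \<and> col2 w = b + d \<and> (\<forall>v. word w v = (a * fst v + b * snd v, c * fst v + d * snd v))"
proof -
  have "\<exists>a b c d. 0 \<le> a \<and> 0 \<le> b \<and> 0 \<le> c \<and> 0 \<le> d \<and> a * d - b * c = 1 \<and>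
     (\<forall>v. word w v = (a * fst v + b * snd v, c * fst v + d * snd v))"
  proof (induction w)
    case Nil
    show ?case by (rule exI[of _ 1], rule exI[of _ 0], rule exI[of _ 0], rule exI[of _ 1]) simp
  next
    case (Cons x w)
    then obtain a b c d where "0 \<le> a" "0 \<le> b" "0 \<le> c" "0 \<le> d"
      and "a * d = b * c + 1" and m: "\<And>v. word w v = (a * fst v + b * snd v, c * fst v + d * snd v)"
      by (auto simp: algebra_simps)
    then have * : "0 \<le> a" "0 \<le> b" "0 \<le> c" "0 \<le> d" "a * d = b * c + 1" by auto
    show ?case
    proof (cases x)
      case True
      show ?thesis
        by (rule exI[of _ "a + c"], rule exI[of _ "b + d"], rule exI[of _ c], rule exI[of _ d])
          (simp add: * m True letter_simps algebra_simps)
    next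
      case False
      show ?thesis
        by (rule exI[of _ a], rule exI[of _ b], rule exI[of _ "a + c"], rule exI[of _ "b + d"])
          (simp add: * m False letter_simps algebra_simps)
    qed
  qed
  then show ?thesis unfolding col1_def col2_def by fastforce
qed

lemma norm1_word: "fst (word w v) + snd (word w v) = col1 w * fst v + col2 w * snd v"
proof -
  obtain a b c d where "col1 w = a + c" "col2 w = b + d"
      and "\<And>v. word w v = (a * fst v + b * snd v, c * fst v + d * snd v)"
    using word_matrix[of w] by blast
  then show ?thesis by (simp add: algebra_simps)
qed

lemma col_pos: "0 < col1 w" "0 < col2 w"
proof -
  obtain a b c d where *: "0 \<le> a" "0 \<le> b" "0 \<le> c" "0 \<le> d" "a * d - b * c = 1"
      "col1 w = a + c" "col2 w = b + d" using word_matrix[of w] by blast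
  \<comment> \<open>A vanishing column sum would make both entries of that column zero, hence the
    determinant 0.\<close>
  have "a + c \<noteq> 0" "b + d \<noteq> 0" using * by (auto simp: add_nonneg_eq_0_iff)
  then show "0 < col1 w" "0 < col2 w" using * by auto
qed

lemma col_append:
  "col1 (w @ u) = col1 w * fst (word u (1, 0)) + col2 w * snd (word u (1, 0))"
  "col2 (w @ u) = col1 w * fst (word u (0, 1)) + col2 w * snd (word u (0, 1))"
  unfolding col1_def[of "w @ u"] col2_def[of "w @ u"] by (simp_all add: norm1_word)

text \<open>A word ending in two different letters has column sums with ratio between 1/2 and 2, and appending
  a block \<open>b\<^sup>k \<not>b\<close> with \<open>k \<ge> 1\<close> at least doubles both column sums.\<close>

lemma exists_balanced_word:
  fixes Z :: "real \<times> real \<Rightarrow> real"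
  assumes Z: "integrable plane Z" and pos: "(\<integral>v. indicator quad v * Z v \<partial>plane) > 0"
  shows "\<exists>w. (\<integral>v. indicator quad v * Z (word w v) \<partial>plane) > 0 \<and>
     2 ^ Suc n \<le> col1 w \<and> 2 ^ Suc n \<le> col2 w \<and> col1 w \<le> 2 * col2 w \<and> col2 w \<le> 2 * col1 w"
proof -
  have extend: "\<exists>w'. (\<integral>v. indicator quad v * Z (word w' v) \<partial>plane) > 0 \<and>
     2 * m \<le> col1 w' \<and> 2 * m \<le> col2 w' \<and> col1 w' \<le> 2 * col2 w' \<and> col2 w' \<le> 2 * col1 w'"
    if w: "(\<integral>v. indicator quad v * Z (word w v) \<partial>plane) > 0" "m \<le> col1 w" "m \<le> col2 w" for w m
  proof -
    \<comment> \<open>The block found below may have \<open>k = 0\<close>. Prepending a letter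
      \<open>b\<close> whose subcone keeps the integral positive guarantees at least one
      \<open>b\<close> before the change of letter.\<close>
    have "(\<integral>v. indicator quad v * Z (word (w @ [True]) v) \<partial>plane) > 0
        \<or> (\<integral>v. indicator quad v * Z (word (w @ [False]) v) \<partial>plane) > 0"
      using integral_letter_split[OF integrable_word[OF Z, of w], of True] w(1) by auto
    then obtain b where b: "(\<integral>v. indicator quad v * Z (word (w @ [b]) v) \<partial>plane) > 0"
      by blast
    obtain k where k: "(\<integral>v. indicator quad v * Z (word (w @ [b]) (word (replicate k b @ [\<not> b]) v)) \<partial>plane) > 0"
      using exists_block_integral_pos[OF integrable_word[OF Z], of "w @ [b]" b] b by blast
    let ?u = "[b] @ replicate k b @ [\<not> b]"
    \<comment> \<open>With q1, q2 the column sums of \<open>w\<close>, the new sums for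
      \<open>b = True\<close> are (k+2) q1 + q2 and (k+1) q1 + q2; for \<open>b = False\<close> they
      are q1 + (k+1) q2 and q1 + (k+2) q2.\<close>
    have "2 * m \<le> col1 (w @ ?u) \<and> 2 * m \<le> col2 (w @ ?u) \<and> col1 (w @ ?u) \<le> 2 * col2 (w @ ?u)
        \<and> col2 (w @ ?u) \<le> 2 * col1 (w @ ?u)"
    proof -
      have nn: "0 \<le> real k * col1 w" "0 \<le> real k * col2 w" using col_pos[of w] by auto
      show ?thesis
        unfolding col_append
        by (cases b; intro conjI; simp add: letter_power letter_simps algebra_simps;
            use nn w(2,3) col_pos[of w] in linarith)
    qed
    then show ?thesis using k by (intro exI[of _ "w @ ?u"]) simp
  qed
  show ?thesis
  proof (induction n)
    case 0
    show ?case using extend[of "[]" 1] pos by (simp add: col1_def col2_def)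
  next
    case (Suc n)
    then show ?case using extend[of _ "2 ^ Suc n"] by fastforce
  qed
qed

section \<open>Functions that are nearly radial in two coordinate systems\<close>

text \<open>A band between two level lines of the 1-norm, half-open so that adjacent bands tile; for
  \<open>a = 0\<close> it is an open triangle.\<close>

definition annulus :: "real \<Rightarrow> real \<Rightarrow> (real \<times> real) set" where
  "annulus a b = {v. v \<in> quad \<and> a \<le> fst v + snd v \<and> fst v + snd v < b}"

lemma annulus_pred [measurable]: "Measurable.pred plane (\<lambda>v. v \<in> annulus a b)"
  unfolding annulus_def mem_Collect_eq by measurable

lemma ennreal_abs_triangle: "ennreal \<bar>a - c\<bar> \<le> ennreal \<bar>a - b\<bar> + ennreal \<bar>b - c\<bar>"
  using ennreal_leI[OF abs_triangle_ineq[of "a - b" "b - c"]] by simp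

lemma ennreal_mult_le_cancel:
  assumes "ennreal a * Y \<le> ennreal b" "a > 0"
  shows "Y \<le> ennreal (b / a)"
proof -
  have "Y = ennreal (1 / a) * (ennreal a * Y)"
    using assms(2) by (simp add: mult.assoc[symmetric] ennreal_mult[symmetric])
  also have "\<dots> \<le> ennreal (1 / a) * ennreal b"
    by (intro mult_left_mono assms) simp
  also have "\<dots> = ennreal (b / a)"
    using assms(2) by (simp add: ennreal_mult'[symmetric])
  finally show ?thesis .
qed

lemma exists_le_average:
  fixes X :: "real \<Rightarrow> ennreal"
  assumes "(\<integral>\<^sup>+x. X x * indicator {a..<b} x \<partial>lborel) < ennreal e" "a < b"
  shows "\<exists>x. X x \<le> ennreal (e / (b - a))"
proof (rule ccontr)
  assume "\<not> ?thesis"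
  then have *: "ennreal (e / (b - a)) \<le> X x" for x
    by (meson linear)
  have "ennreal e = ennreal (e / (b - a)) * ennreal (b - a)"
    using assms(2) by (simp add: ennreal_mult''[symmetric])
  also have "\<dots> = (\<integral>\<^sup>+x. ennreal (e / (b - a)) * indicator {a..<b} x \<partial>lborel)"
    using assms(2) by (simp add: nn_integral_cmult_indicator)
  also have "\<dots> \<le> (\<integral>\<^sup>+x. X x * indicator {a..<b} x \<partial>lborel)"
    by (intro nn_integral_mono mult_right_mono *) simp
  finally show False using assms(1) by simp
qed

text \<open>In the sheared coordinates \<open>(\<rho>, snd v)\<close> with
  \<open>\<rho> = fst v + snd v\<close>, the second one ranges inside an interval of length
  \<open>b\<close>.\<close>

lemma nn_integral_radial_le:
  fixes m :: "real \<Rightarrow> ennreal"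
  assumes [measurable]: "m \<in> borel_measurable borel" and "0 \<le> b"
  shows "(\<integral>\<^sup>+v. m (fst v + snd v) * indicator (annulus a b) v \<partial>plane)
    \<le> ennreal b * (\<integral>\<^sup>+\<rho>. m \<rho> * indicator {a..<b} \<rho> \<partial>lborel)"
proof -
  let ?G = "\<lambda>v. m (fst v) * indicator {a..<b} (fst v) * indicator {0..b} (snd v)"
  have "(\<integral>\<^sup>+v. m (fst v + snd v) * indicator (annulus a b) v \<partial>plane)
      \<le> (\<integral>\<^sup>+v. ?G (fst v + 1 * snd v, snd v) \<partial>plane)"
    by (intro nn_integral_mono) (auto simp: indicator_def annulus_def quad_def)
  also have "\<dots> = (\<integral>\<^sup>+v. ?G v \<partial>plane)"
    by (rule nn_integral_shear) measurable
  also have "\<dots> = (\<integral>\<^sup>+x. m x * indicator {a..<b} x * (\<integral>\<^sup>+y. indicator {0..b} y \<partial>lborel) \<partial>lborel)"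
    by (subst nn_integral_plane_fst) (auto simp: nn_integral_cmult)
  also have "(\<integral>\<^sup>+y. indicator {0..b} y \<partial>lborel) = ennreal b"
    using \<open>0 \<le> b\<close> by simp
  also have "(\<integral>\<^sup>+x. m x * indicator {a..<b} x * ennreal b \<partial>lborel)
      = ennreal b * (\<integral>\<^sup>+\<rho>. m \<rho> * indicator {a..<b} \<rho> \<partial>lborel)"
    by (subst nn_integral_multc) (auto simp: mult.commute)
  finally show ?thesis .
qed

text \<open>\<open>h\<close>, \<open>H\<close> stand for the two indicator functions in the chart of a cone, in which the letter \<open>True\<close>
  becomes the shear with coefficient \<open>\<kappa>\<close>, the ratio of the column sums.\<close>

lemma profiles_double_integral:
  fixes h H :: "real \<times> real \<Rightarrow> real" and \<phi> \<Phi> :: "real \<Rightarrow> real"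
  assumes [measurable]: "h \<in> borel_measurable plane" "H \<in> borel_measurable plane"
      "\<phi> \<in> borel_measurable borel" "\<Phi> \<in> borel_measurable borel"
    and \<kappa>: "1 / 2 \<le> \<kappa>" "\<kappa> \<le> 2"
    and rel: "\<And>v. v \<in> quad \<Longrightarrow> H (fst v + \<kappa> * snd v, snd v) = h v"
  shows "(\<integral>\<^sup>+v. ennreal \<bar>\<phi> (fst v) - \<Phi> (snd v)\<bar>
        * indicator {v. 1 \<le> fst v \<and> fst v < 3 / 2 \<and> fst v < snd v \<and> snd v < fst v + 1 / 2} v \<partial>plane)
    \<le> 2 * ((\<integral>\<^sup>+v. ennreal \<bar>h v - \<phi> (fst v + snd v)\<bar> * indicator (annulus 1 5) v \<partial>plane)
      + (\<integral>\<^sup>+v. ennreal \<bar>H v - \<Phi> (fst v + snd v)\<bar> * indicator (annulus 1 5) v \<partial>plane))"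
    (is "(\<integral>\<^sup>+v. ?P v \<partial>plane) \<le> 2 * ((\<integral>\<^sup>+v. ?e1 v \<partial>plane) + (\<integral>\<^sup>+v. ?e2 v \<partial>plane))")
proof -
  \<comment> \<open>Here the pair holds x = s + t and t for a point (s, t) of the chart:
    \<open>h\<close> sees the radius x, and \<open>H\<close> at the sheared point sees x + \<kappa>
    t. Since t < 1 <= x, the point has s > 0 and lies in \<open>quad\<close>.\<close>
  let ?G = "\<lambda>v. ennreal \<bar>\<phi> (fst v) - \<Phi> (fst v + \<kappa> * snd v)\<bar>
      * indicator {1..<3/2} (fst v) * indicator {0<..<1} (snd v)"
  have "(\<integral>\<^sup>+v. ?P v \<partial>plane) = (\<integral>\<^sup>+x. \<integral>\<^sup>+y. ?P (x, y) \<partial>lborel \<partial>lborel)"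
    by (intro nn_integral_plane_fst) measurable
  also have "\<dots> \<le> (\<integral>\<^sup>+x. 2 * \<integral>\<^sup>+y. ?G (x, y) \<partial>lborel \<partial>lborel)"
  proof (rule nn_integral_mono)
    fix x :: real
    \<comment> \<open>For fixed x the radius y = x + \<kappa> t replaces t. The bound \<kappa> <= 2
      on the Jacobian produces the factor 2 of the statement, and \<kappa> >= 1/2 turns y < x + 1/2
      into t < 1.\<close>
    have "(\<integral>\<^sup>+y. ?P (x, y) \<partial>lborel) = ennreal \<kappa> * (\<integral>\<^sup>+y. ?P (x, x + \<kappa> * y) \<partial>lborel)"
      using \<kappa> nn_integral_real_affine[of "\<lambda>y. ?P (x, y)" \<kappa> x] by simp
    also have "\<dots> \<le> 2 * (\<integral>\<^sup>+y. ?G (x, y) \<partial>lborel)"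
    proof (rule mult_mono[OF _ nn_integral_mono])
      show "ennreal \<kappa> \<le> 2"
        using ennreal_leI[OF \<kappa>(2)] by simp
      fix y :: real
      have "0 < y" if "0 < \<kappa> * y" using that \<kappa> by (simp add: zero_less_mult_iff)
      moreover have "y < 1" if "\<kappa> * y < 1 / 2" "0 < y"
        using mult_right_mono[OF \<kappa>(1), of y] that by linarith
      ultimately show "?P (x, x + \<kappa> * y) \<le> ?G (x, y)"
        by (auto simp: indicator_def)
    qed auto
    finally show "(\<integral>\<^sup>+y. ?P (x, y) \<partial>lborel) \<le> 2 * (\<integral>\<^sup>+y. ?G (x, y) \<partial>lborel)" .
  qed
  also have "\<dots> = 2 * (\<integral>\<^sup>+x. \<integral>\<^sup>+y. ?G (x, y) \<partial>lborel \<partial>lborel)"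
    by (rule nn_integral_cmult) measurable
  also have "(\<integral>\<^sup>+x. \<integral>\<^sup>+y. ?G (x, y) \<partial>lborel \<partial>lborel) = (\<integral>\<^sup>+v. ?G v \<partial>plane)"
    by (intro nn_integral_plane_fst[symmetric]) measurable
  also have "(\<integral>\<^sup>+v. ?G v \<partial>plane) = (\<integral>\<^sup>+v. ?G (fst v + 1 * snd v, snd v) \<partial>plane)"
    by (rule nn_integral_shear[symmetric]) measurable
  also have "\<dots> \<le> (\<integral>\<^sup>+v. ?e1 v + ?e2 (fst v + \<kappa> * snd v, snd v) \<partial>plane)"
  proof (rule nn_integral_mono)
    fix v :: "real \<times> real"
    show "?G (fst v + 1 * snd v, snd v) \<le> ?e1 v + ?e2 (fst v + \<kappa> * snd v, snd v)"
    proof (cases "1 \<le> fst v + snd v \<and> fst v + snd v < 3 / 2 \<and> 0 < snd v \<and> snd v < 1")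
      case True
      have "0 \<le> \<kappa> * snd v" "\<kappa> * snd v \<le> 2 * snd v" using True \<kappa> by auto
      with True have "fst v + \<kappa> * snd v + snd v < 5" "1 \<le> fst v + \<kappa> * snd v + snd v" by linarith+
      then have *: "v \<in> quad" "v \<in> annulus 1 5" "(fst v + \<kappa> * snd v, snd v) \<in> annulus 1 5"
        using True \<open>0 \<le> \<kappa> * snd v\<close> by (auto simp: annulus_def quad_def)
      show ?thesis
        using True * rel[OF *(1)] ennreal_abs_triangle[of "\<phi> (fst v + snd v)" "\<Phi> (fst v + \<kappa> * snd v + snd v)" "h v"]
        by (simp add: abs_minus_commute[of "h v" "\<phi> _"] algebra_simps)
    qed (auto simp: indicator_def)
  qed
  also have "\<dots> = (\<integral>\<^sup>+v. ?e1 v \<partial>plane) + (\<integral>\<^sup>+v. ?e2 (fst v + \<kappa> * snd v, snd v) \<partial>plane)"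
    by (rule nn_integral_add) measurable
  also have "(\<integral>\<^sup>+v. ?e2 (fst v + \<kappa> * snd v, snd v) \<partial>plane) = (\<integral>\<^sup>+v. ?e2 v \<partial>plane)"
    by (rule nn_integral_shear) measurable
  finally show ?thesis
    by (simp add: mult_left_mono)
qed

text \<open>The strip contains the rectangles [1, 7/5) x [7/5, 3/2) and [1, 11/10) x [11/10, 7/5).
  In the first, some value \<open>c\<close> of \<open>\<Phi>\<close> is close to
  \<open>\<phi>\<close> on average; the side 1/10 costs the factor 10. In the second, averaging over
  x compares \<open>\<Phi>\<close> with \<open>\<phi>\<close> and so with \<open>c\<close>.\<close>

lemma profiles_nearly_constant:
  fixes \<phi> \<Phi> :: "real \<Rightarrow> real"
  assumes [measurable]: "\<phi> \<in> borel_measurable borel" "\<Phi> \<in> borel_measurable borel"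
    and K: "(\<integral>\<^sup>+v. ennreal \<bar>\<phi> (fst v) - \<Phi> (snd v)\<bar>
        * indicator {v. 1 \<le> fst v \<and> fst v < 3 / 2 \<and> fst v < snd v \<and> snd v < fst v + 1 / 2} v \<partial>plane)
      < ennreal e" (is "(\<integral>\<^sup>+v. ?P v \<partial>plane) < _")
  shows "\<exists>c. (\<integral>\<^sup>+\<rho>. ennreal \<bar>\<phi> \<rho> - c\<bar> * indicator {1..<7/5} \<rho> \<partial>lborel) \<le> ennreal (10 * e)
           \<and> (\<integral>\<^sup>+\<rho>. ennreal \<bar>\<Phi> \<rho> - c\<bar> * indicator {11/10..<7/5} \<rho> \<partial>lborel) \<le> ennreal (40 * e)"
proof -
  have "e > 0" using le_less_trans[OF zero_le K] by simp
  let ?X = "\<lambda>y. \<integral>\<^sup>+x. ennreal \<bar>\<phi> x - \<Phi> y\<bar> * indicator {1..<7/5} x \<partial>lborel"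
  have "(\<integral>\<^sup>+y. ?X y * indicator {7/5..<3/2} y \<partial>lborel)
      = (\<integral>\<^sup>+y. \<integral>\<^sup>+x. ennreal \<bar>\<phi> x - \<Phi> y\<bar> * indicator {1..<7/5} x * indicator {7/5..<3/2} y \<partial>lborel \<partial>lborel)"
    by (intro nn_integral_cong nn_integral_multc[symmetric]) measurable
  also have "\<dots> \<le> (\<integral>\<^sup>+y. \<integral>\<^sup>+x. ?P (x, y) \<partial>lborel \<partial>lborel)"
    by (intro nn_integral_mono) (auto simp: indicator_def)
  also have "\<dots> = (\<integral>\<^sup>+v. ?P v \<partial>plane)"
    by (intro nn_integral_plane_snd[symmetric]) measurable
  also note K
  finally obtain y0 where y0: "?X y0 \<le> ennreal (e / (3/2 - 7/5))"
    using exists_le_average[of ?X "7/5" "3/2" e] by auto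
  define c where "c = \<Phi> y0"
  have 1: "(\<integral>\<^sup>+x. ennreal \<bar>\<phi> x - c\<bar> * indicator {1..<7/5} x \<partial>lborel) \<le> ennreal (10 * e)"
    using y0 by (simp add: c_def mult.commute)
  let ?Y = "\<lambda>y. ennreal \<bar>\<Phi> y - c\<bar> * indicator {11/10..<7/5} y"
  let ?A = "\<lambda>x (y::real). ennreal \<bar>\<phi> x - \<Phi> y\<bar> * indicator {1..<11/10} x * indicator {11/10..<7/5} y"
  let ?B = "\<lambda>x (y::real). ennreal \<bar>\<phi> x - c\<bar> * indicator {1..<11/10} x * indicator {11/10..<7/5} y"
  have "ennreal (1/10) * (\<integral>\<^sup>+y. ?Y y \<partial>lborel) = (\<integral>\<^sup>+y. ennreal (1/10) * ?Y y \<partial>lborel)"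
    by (rule nn_integral_cmult[symmetric]) measurable
  also have "\<dots> \<le> (\<integral>\<^sup>+y. (\<integral>\<^sup>+x. ?A x y \<partial>lborel) + (\<integral>\<^sup>+x. ?B x y \<partial>lborel) \<partial>lborel)"
  proof (rule nn_integral_mono)
    fix y :: real
    have "ennreal (1/10) * ?Y y = (\<integral>\<^sup>+x. ?Y y * indicator {1..<11/10::real} x \<partial>lborel)"
      by (subst nn_integral_cmult_indicator) (auto simp: mult.commute)
    also have "\<dots> \<le> (\<integral>\<^sup>+x. ?A x y + ?B x y \<partial>lborel)"
    proof (rule nn_integral_mono)
      fix x :: real
      show "?Y y * indicator {1..<11/10} x \<le> ?A x y + ?B x y"
        using ennreal_abs_triangle[of "\<Phi> y" c "\<phi> x"]
        by (auto simp: indicator_def abs_minus_commute[of "\<phi> _" "\<Phi> _"])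
    qed
    also have "\<dots> = (\<integral>\<^sup>+x. ?A x y \<partial>lborel) + (\<integral>\<^sup>+x. ?B x y \<partial>lborel)"
      by (rule nn_integral_add) measurable
    finally show "ennreal (1/10) * ?Y y \<le> (\<integral>\<^sup>+x. ?A x y \<partial>lborel) + (\<integral>\<^sup>+x. ?B x y \<partial>lborel)" .
  qed
  also have "\<dots> = (\<integral>\<^sup>+y. \<integral>\<^sup>+x. ?A x y \<partial>lborel \<partial>lborel) + (\<integral>\<^sup>+y. \<integral>\<^sup>+x. ?B x y \<partial>lborel \<partial>lborel)"
    by (rule nn_integral_add) measurable
  \<comment> \<open>The second summand is 3/10, the length of the y-interval, times the bound 10 e
    already obtained.\<close>
  also have "\<dots> \<le> ennreal e + ennreal (3 * e)"
  proof (rule add_mono)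
    have "(\<integral>\<^sup>+y. \<integral>\<^sup>+x. ?A x y \<partial>lborel \<partial>lborel) \<le> (\<integral>\<^sup>+y. \<integral>\<^sup>+x. ?P (x, y) \<partial>lborel \<partial>lborel)"
      by (intro nn_integral_mono) (auto simp: indicator_def)
    also have "\<dots> = (\<integral>\<^sup>+v. ?P v \<partial>plane)"
      by (intro nn_integral_plane_snd[symmetric]) measurable
    finally show "(\<integral>\<^sup>+y. \<integral>\<^sup>+x. ?A x y \<partial>lborel \<partial>lborel) \<le> ennreal e"
      using K by simp
    have "(\<integral>\<^sup>+y. \<integral>\<^sup>+x. ?B x y \<partial>lborel \<partial>lborel)
        = (\<integral>\<^sup>+y. (\<integral>\<^sup>+x. ennreal \<bar>\<phi> x - c\<bar> * indicator {1..<11/10} x \<partial>lborel) * indicator {11/10..<7/5::real} y \<partial>lborel)"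
      by (intro nn_integral_cong nn_integral_multc) measurable
    also have "\<dots> = (\<integral>\<^sup>+x. ennreal \<bar>\<phi> x - c\<bar> * indicator {1..<11/10} x \<partial>lborel) * ennreal (3/10)"
      by (subst nn_integral_cmult_indicator) auto
    also have "\<dots> \<le> (\<integral>\<^sup>+x. ennreal \<bar>\<phi> x - c\<bar> * indicator {1..<7/5} x \<partial>lborel) * ennreal (3/10)"
      by (intro mult_right_mono nn_integral_mono) (auto simp: indicator_def)
    also have "\<dots> \<le> ennreal (10 * e) * ennreal (3/10)"
      by (intro mult_right_mono 1) simp
    also have "\<dots> = ennreal (3 * e)"
      using \<open>e > 0\<close> by (simp add: ennreal_mult[symmetric])
    finally show "(\<integral>\<^sup>+y. \<integral>\<^sup>+x. ?B x y \<partial>lborel \<partial>lborel) \<le> ennreal (3 * e)" .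
  qed
  also have "\<dots> = ennreal (4 * e)"
    using \<open>e > 0\<close> by (simp add: ennreal_plus[symmetric] del: ennreal_plus)
  finally have "(\<integral>\<^sup>+y. ?Y y \<partial>lborel) \<le> ennreal (4 * e / (1/10))"
    by (rule ennreal_mult_le_cancel) simp
  then show ?thesis using 1 by (intro exI[of _ c]) simp
qed

text \<open>The double integral forces both profiles towards one constant, and \<open>h\<close>,
  \<open>H\<close> follow by the triangle inequality.\<close>

lemma nearly_constant_of_profiles:
  fixes h H :: "real \<times> real \<Rightarrow> real" and \<phi> \<Phi> :: "real \<Rightarrow> real"
  assumes [measurable]: "h \<in> borel_measurable plane" "H \<in> borel_measurable plane"
      "\<phi> \<in> borel_measurable borel" "\<Phi> \<in> borel_measurable borel"
    and \<kappa>: "1 / 2 \<le> \<kappa>" "\<kappa> \<le> 2"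
    and rel: "\<And>v. v \<in> quad \<Longrightarrow> H (fst v + \<kappa> * snd v, snd v) = h v"
    and e: "(\<integral>\<^sup>+v. ennreal \<bar>h v - \<phi> (fst v + snd v)\<bar> * indicator (annulus 1 5) v \<partial>plane)
      + (\<integral>\<^sup>+v. ennreal \<bar>H v - \<Phi> (fst v + snd v)\<bar> * indicator (annulus 1 5) v \<partial>plane) < ennreal e"
  shows "\<exists>c. (\<integral>\<^sup>+v. ennreal \<bar>h v - c\<bar> * indicator (annulus (11/10) (7/5)) v \<partial>plane) \<le> ennreal (200 * e)
           \<and> (\<integral>\<^sup>+v. ennreal \<bar>H v - c\<bar> * indicator (annulus (11/10) (7/5)) v \<partial>plane) \<le> ennreal (200 * e)"
proof -
  have "e > 0" using le_less_trans[OF zero_le e] by simp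
  have close: "(\<integral>\<^sup>+v. ennreal \<bar>f v - c\<bar> * indicator (annulus (11/10) (7/5)) v \<partial>plane) \<le> ennreal (200 * e)"
    if m: "f \<in> borel_measurable plane" "p \<in> borel_measurable borel"
      and fp: "(\<integral>\<^sup>+v. ennreal \<bar>f v - p (fst v + snd v)\<bar> * indicator (annulus 1 5) v \<partial>plane) \<le> ennreal e"
      and pc: "(\<integral>\<^sup>+\<rho>. ennreal \<bar>p \<rho> - c\<bar> * indicator {11/10..<7/5} \<rho> \<partial>lborel) \<le> ennreal (80 * e)"
    for f :: "real \<times> real \<Rightarrow> real" and p c
  proof -
    note m [measurable]
    have "(\<integral>\<^sup>+v. ennreal \<bar>f v - c\<bar> * indicator (annulus (11/10) (7/5)) v \<partial>plane)
        \<le> (\<integral>\<^sup>+v. ennreal \<bar>f v - p (fst v + snd v)\<bar> * indicator (annulus 1 5) v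
            + ennreal \<bar>p (fst v + snd v) - c\<bar> * indicator (annulus (11/10) (7/5)) v \<partial>plane)"
      by (intro nn_integral_mono) (auto simp: indicator_def annulus_def ennreal_abs_triangle)
    also have "\<dots> = (\<integral>\<^sup>+v. ennreal \<bar>f v - p (fst v + snd v)\<bar> * indicator (annulus 1 5) v \<partial>plane)
            + (\<integral>\<^sup>+v. ennreal \<bar>p (fst v + snd v) - c\<bar> * indicator (annulus (11/10) (7/5)) v \<partial>plane)"
      by (rule nn_integral_add) measurable
    \<comment> \<open>The 80 is 40 from averaging times 2 from the Jacobian, and 7/5 is the radial
      factor; 1 + 7/5 * 80 = 113 is rounded up to 200.\<close>
    also have "\<dots> \<le> ennreal e + ennreal (7/5) * ennreal (80 * e)"
      by (intro add_mono fp order_trans[OF nn_integral_radial_le mult_left_mono[OF pc]]) auto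
    also have "\<dots> \<le> ennreal (200 * e)"
      using \<open>e > 0\<close> by (simp add: ennreal_mult[symmetric] ennreal_plus[symmetric] del: ennreal_plus)
    finally show ?thesis .
  qed
  have "(\<integral>\<^sup>+v. ennreal \<bar>\<phi> (fst v) - \<Phi> (snd v)\<bar>
        * indicator {v. 1 \<le> fst v \<and> fst v < 3 / 2 \<and> fst v < snd v \<and> snd v < fst v + 1 / 2} v \<partial>plane)
      < ennreal (2 * e)"
    using profiles_double_integral[OF assms(1-7)] ennreal_mult_strict_left_mono[OF e, of 2]
    by (simp add: ennreal_mult')
  from profiles_nearly_constant[OF assms(3,4) this] obtain c where
    c1: "(\<integral>\<^sup>+\<rho>. ennreal \<bar>\<phi> \<rho> - c\<bar> * indicator {1..<7/5} \<rho> \<partial>lborel) \<le> ennreal (10 * (2 * e))" and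
    c2: "(\<integral>\<^sup>+\<rho>. ennreal \<bar>\<Phi> \<rho> - c\<bar> * indicator {11/10..<7/5} \<rho> \<partial>lborel) \<le> ennreal (40 * (2 * e))"
    by blast
  have "(\<integral>\<^sup>+\<rho>. ennreal \<bar>\<phi> \<rho> - c\<bar> * indicator {11/10..<7/5} \<rho> \<partial>lborel)
      \<le> (\<integral>\<^sup>+\<rho>. ennreal \<bar>\<phi> \<rho> - c\<bar> * indicator {1..<7/5} \<rho> \<partial>lborel)"
    by (intro nn_integral_mono) (auto simp: indicator_def)
  also note c1
  also have "ennreal (10 * (2 * e)) \<le> ennreal (80 * e)"
    using \<open>e > 0\<close> by (intro ennreal_leI) simp
  finally have c1': "(\<integral>\<^sup>+\<rho>. ennreal \<bar>\<phi> \<rho> - c\<bar> * indicator {11/10..<7/5} \<rho> \<partial>lborel) \<le> ennreal (80 * e)" .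
  have e1: "(\<integral>\<^sup>+v. ennreal \<bar>h v - \<phi> (fst v + snd v)\<bar> * indicator (annulus 1 5) v \<partial>plane) \<le> ennreal e"
    and e2: "(\<integral>\<^sup>+v. ennreal \<bar>H v - \<Phi> (fst v + snd v)\<bar> * indicator (annulus 1 5) v \<partial>plane) \<le> ennreal e"
    using le_less_trans[OF _ e] by (auto intro!: less_imp_le)
  show ?thesis
    using close[OF _ _ e1 c1'] close[OF _ _ e2, of c] c2 by auto
qed

section \<open>Narrow cones\<close>

lemma continuous_plane_measurable [measurable_dest]:
  fixes g :: "real \<times> real \<Rightarrow> real"
  assumes "continuous_on UNIV g"
  shows "g \<in> borel_measurable plane"
proof -
  have "g \<in> borel_measurable lborel"
    using borel_measurable_continuous_onI[OF assms] by simp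
  then show ?thesis unfolding lborel_prod .
qed

text \<open>Outer regularity of both S and its complement gives a closed set inside S and an open
  set around S, and a Urysohn function between them differs from the indicator only on two sets of
  measure below e/2. This also covers sets S of infinite measure.\<close>

lemma indicator_approx_continuous:
  assumes S: "S \<in> sets plane" and e: "e > 0"
  shows "\<exists>g :: real \<times> real \<Rightarrow> real. continuous_on UNIV g \<and>
    (\<integral>\<^sup>+v. ennreal \<bar>indicator S v - g v\<bar> \<partial>plane) \<le> ennreal e"
proof -
  have S': "S \<in> sets borel" using S unfolding lborel_prod by simp
  have "e / 2 > 0" using e by simp
  obtain U where U: "open U" "S \<subseteq> U" "emeasure lborel (U - S) < e / 2"
    by (rule outer_regular_lborel[OF S' \<open>e / 2 > 0\<close>])
  have "- S \<in> sets borel" using S' by simp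
  then obtain V where V: "open V" "- S \<subseteq> V" "emeasure lborel (V - - S) < e / 2"
    by (rule outer_regular_lborel[OF _ \<open>e / 2 > 0\<close>])
  have "closed (- V)" "closed (- U)" "- V \<inter> - U = {}"
    using U V by auto
  then obtain g :: "real \<times> real \<Rightarrow> real" where g: "continuous_on UNIV g"
      "\<And>x. g x \<in> closed_segment 1 0" "\<And>x. x \<in> - V \<Longrightarrow> g x = 1" "\<And>x. x \<in> - U \<Longrightarrow> g x = 0"
    by (rule Urysohn[where a="1::real" and b=0]) (rule that, blast+)
  have g01: "0 \<le> g x \<and> g x \<le> 1" for x
    using g(2)[of x] by (simp add: closed_segment_eq_real_ivl)
  have UV: "U - S \<in> sets lborel" "V - - S \<in> sets lborel"
    using S' U(1) V(1) by auto
  have "(\<integral>\<^sup>+v. ennreal \<bar>indicator S v - g v\<bar> \<partial>lborel)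
      \<le> (\<integral>\<^sup>+v. indicator (U - S) v + indicator (V - - S) v \<partial>lborel)"
  proof (rule nn_integral_mono)
    fix v
    show "ennreal \<bar>indicator S v - g v\<bar> \<le> indicator (U - S) v + indicator (V - - S) v"
      using g01[of v] g(3)[of v] g(4)[of v] U(2) V(2)
      by (cases "v \<in> S"; cases "v \<in> U"; cases "v \<in> V") (auto simp: indicator_def)
  qed
  also have "\<dots> = emeasure lborel (U - S) + emeasure lborel (V - - S)"
    using UV by (subst nn_integral_add) auto
  also have "\<dots> \<le> ennreal (e / 2) + ennreal (e / 2)"
    using U(3) V(3) by (intro add_mono) auto
  also have "\<dots> = ennreal e"
    using e by (simp add: ennreal_plus[symmetric] del: ennreal_plus)
  finally show ?thesis using g(1) unfolding lborel_prod by blast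
qed

text \<open>Parametrises the cone of \<open>w\<close> with each column divided by its sum. This
  preserves the 1-norm, so annuli do not depend on the cone.\<close>

definition cone_chart :: "bool list \<Rightarrow> real \<times> real \<Rightarrow> real \<times> real" where
  "cone_chart w v = word w (fst v / col1 w, snd v / col2 w)"

lemma cone_chart_measurable [measurable]: "cone_chart w \<in> measurable plane plane"
  unfolding cone_chart_def by measurable

lemma norm1_cone_chart: "fst (cone_chart w v) + snd (cone_chart w v) = fst v + snd v"
  using col_pos[of w] by (simp add: cone_chart_def norm1_word)

lemma cone_chart_quad: "v \<in> quad \<Longrightarrow> cone_chart w v \<in> quad"
  unfolding cone_chart_def using col_pos[of w] by (intro word_quad) (auto simp: quad_def)

lemma cone_chart_annulus: "v \<in> annulus a b \<Longrightarrow> cone_chart w v \<in> annulus a b"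
  using cone_chart_quad[of v w] by (auto simp: annulus_def norm1_cone_chart)

lemma cone_chart_scale: "cone_chart w (c * fst v, c * snd v) = (c * fst (cone_chart w v), c * snd (cone_chart w v))"
proof -
  obtain a b p d where "\<And>v. word w v = (a * fst v + b * snd v, p * fst v + d * snd v)"
    using word_matrix[of w] by blast
  then show ?thesis by (simp add: cone_chart_def algebra_simps)
qed

lemma nn_integral_cone_chart:
  assumes [measurable]: "F \<in> borel_measurable plane"
  shows "(\<integral>\<^sup>+v. F (word w v) * indicator quad v \<partial>plane)
    = ennreal (1 / (col1 w * col2 w)) * (\<integral>\<^sup>+v. F (cone_chart w v) * indicator quad v \<partial>plane)"
proof -
  have "(\<integral>\<^sup>+v. F (word w v) * indicator quad v \<partial>plane)
      = ennreal (1 / col1 w * (1 / col2 w)) * (\<integral>\<^sup>+v. F (word w (1 / col1 w * fst v, 1 / col2 w * snd v))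
          * indicator quad (1 / col1 w * fst v, 1 / col2 w * snd v) \<partial>plane)"
    using col_pos[of w] by (intro nn_integral_diagonal_scaling) auto
  also have "(\<integral>\<^sup>+v. F (word w (1 / col1 w * fst v, 1 / col2 w * snd v))
          * indicator quad (1 / col1 w * fst v, 1 / col2 w * snd v) \<partial>plane)
      = (\<integral>\<^sup>+v. F (cone_chart w v) * indicator quad v \<partial>plane)"
    using col_pos[of w]
    by (intro nn_integral_cong) (auto simp: cone_chart_def indicator_def quad_def zero_less_divide_iff)
  finally show ?thesis by simp
qed

text \<open>Because the determinant is 1, the two normalised columns differ by (-1, 1) / (q1 q2).
  The comparison point has the same 1-norm on the boundary ray spanned by the first column.\<close>

lemma cone_chart_narrow:
  assumes v: "v \<in> annulus 0 r"
  shows "dist (cone_chart w v) (cone_chart w (fst v + snd v, 0)) \<le> 2 * r / (col1 w * col2 w)"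
proof -
  obtain a b c d where m: "a * d - b * c = 1" "col1 w = a + c" "col2 w = b + d"
      "\<And>v. word w v = (a * fst v + b * snd v, c * fst v + d * snd v)"
    using word_matrix[of w] by blast
  have pos: "0 < col1 w" "0 < col2 w" by (rule col_pos)+
  have "a * d = 1 + b * c" using m(1) by simp
  then have m': "a * d * snd v = snd v + b * c * snd v" by (simp add: distrib_right)
  define t where "t = snd v / (col1 w * col2 w)"
  have 1: "b * snd v / col2 w - a * snd v / col1 w = - t"
    unfolding t_def using pos m' unfolding m(2,3) by (simp add: divide_simps) (simp add: algebra_simps)
  have 2: "d * snd v / col2 w - c * snd v / col1 w = t"
    unfolding t_def using pos m' unfolding m(2,3) by (simp add: divide_simps) (simp add: algebra_simps)
  have "cone_chart w v - cone_chart w (fst v + snd v, 0) = (- t, t)"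
    using 1 2 by (simp add: cone_chart_def m(4) add_divide_distrib algebra_simps)
  then have "dist (cone_chart w v) (cone_chart w (fst v + snd v, 0)) \<le> \<bar>t\<bar> + \<bar>t\<bar>"
    using norm_Pair_le[of "- t" t] by (simp add: dist_norm)
  also have "\<dots> = 2 * snd v / (col1 w * col2 w)"
    using v pos by (simp add: t_def annulus_def quad_def)
  also have "\<dots> \<le> 2 * r / (col1 w * col2 w)"
    using v pos by (intro divide_right_mono) (auto simp: annulus_def quad_def)
  finally show ?thesis .
qed

text \<open>On a narrow cone \<open>g\<close> is nearly a function of the 1-norm alone; its values
  on the boundary ray serve as the profile.\<close>

lemma continuous_on_narrow_cones:
  fixes g :: "real \<times> real \<Rightarrow> real"
  assumes g: "continuous_on UNIV g" and \<delta>: "\<delta> > 0"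
  shows "\<exists>n0. \<forall>n\<ge>n0. \<forall>w. 2 ^ Suc n \<le> col1 w \<and> 2 ^ Suc n \<le> col2 w \<longrightarrow>
    (\<forall>v\<in>annulus 1 5. \<bar>g (cone_chart w v) - g (cone_chart w (fst v + snd v, 0))\<bar> \<le> \<delta>)"
proof -
  have "uniformly_continuous_on (cball 0 5) g"
    by (intro compact_uniformly_continuous continuous_on_subset[OF g]) auto
  then obtain d where d: "d > 0"
      "\<And>x y. x \<in> cball 0 5 \<Longrightarrow> y \<in> cball 0 5 \<Longrightarrow> dist y x < d \<Longrightarrow> dist (g y) (g x) < \<delta>"
    unfolding uniformly_continuous_on_def using \<delta> by metis
  \<comment> \<open>The 10 is \<open>2 * r\<close> in \<open>cone_chart_narrow\<close> with
    \<open>r = 5\<close>.\<close>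
  obtain n0 where n0: "10 / d < 2 ^ n0"
    using real_arch_pow[of 2 "10 / d"] by auto
  have bounded: "x \<in> cball 0 5" if "0 \<le> fst x" "0 \<le> snd x" "fst x + snd x < 5" for x :: "real \<times> real"
    using norm_Pair_le[of "fst x" "snd x"] that by simp
  have "\<bar>g (cone_chart w v) - g (cone_chart w (fst v + snd v, 0))\<bar> \<le> \<delta>"
    if n: "n \<ge> n0" and w: "2 ^ Suc n \<le> col1 w" "2 ^ Suc n \<le> col2 w" and v: "v \<in> annulus 1 5" for n w v
  proof -
    have "10 / d < 2 ^ n0 * 1" using n0 by simp
    also have "\<dots> \<le> 2 ^ Suc n * 2 ^ Suc n"
      using n by (intro mult_mono power_increasing one_le_power) auto
    also have "\<dots> \<le> col1 w * col2 w"
      using w by (intro mult_mono) (auto intro: order_trans[rotated])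
    finally have "10 / (col1 w * col2 w) < d"
      using d(1) col_pos[of w] by (simp add: divide_simps mult.commute)
    moreover have "v \<in> annulus 0 5" using v by (auto simp: annulus_def)
    ultimately have dist: "dist (cone_chart w v) (cone_chart w (fst v + snd v, 0)) < d"
      using cone_chart_narrow[of v 5 w] by simp
    have "cone_chart w v \<in> cball 0 5"
      using cone_chart_annulus[OF v, of w] by (intro bounded) (auto simp: annulus_def quad_def)
    moreover have "cone_chart w (fst v + snd v, 0) \<in> cball 0 5"
    proof (rule bounded)
      obtain a b c e where m: "0 \<le> a" "0 \<le> c"
          "\<And>v. word w v = (a * fst v + b * snd v, c * fst v + e * snd v)"
        using word_matrix[of w] by blast
      show "0 \<le> fst (cone_chart w (fst v + snd v, 0))" "0 \<le> snd (cone_chart w (fst v + snd v, 0))"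
        using m(1,2) v col_pos[of w] by (auto simp: cone_chart_def m(3) annulus_def)
      show "fst (cone_chart w (fst v + snd v, 0)) + snd (cone_chart w (fst v + snd v, 0)) < 5"
        using v by (simp add: norm1_cone_chart annulus_def)
    qed
    ultimately show ?thesis
      using d(2)[OF _ _ dist] by (simp add: dist_real_def)
  qed
  then show ?thesis by blast
qed

text \<open>\<open>T\<close> plays the role of the preimage of \<open>S\<close> under the Euclidean algorithm. Unlike tail sets, these
  pairs are visibly stable under dilations.\<close>

definition tail_pair :: "(real \<times> real) set \<Rightarrow> (real \<times> real) set \<Rightarrow> bool" where
  "tail_pair S T \<longleftrightarrow> S \<in> sets plane \<and> T \<in> sets plane \<and>
     (\<forall>w b. \<forall>v\<in>quad. word w (letter b v) \<in> T \<longleftrightarrow> word w v \<in> S)"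

text \<open>\<open>X\<close> collects the two approximation errors and, as
  \<open>2 * \<delta>\<close>, the cost of replacing \<open>g\<close> and \<open>G\<close> by their
  values on the boundary ray. The tail relation enters only for the letter \<open>True\<close>,
  which is a shear in the chart.\<close>

lemma tail_pair_nearly_constant:
  assumes ST: "tail_pair S T"
    and g: "continuous_on UNIV g" and G: "continuous_on UNIV G"
    and ratio: "col1 w \<le> 2 * col2 w" "col2 w \<le> 2 * col1 w"
    and narrow: "\<And>v. v \<in> annulus 1 5 \<Longrightarrow> \<bar>g (cone_chart w v) - g (cone_chart w (fst v + snd v, 0))\<bar> \<le> \<delta>"
      "\<And>v. v \<in> annulus 1 5 \<Longrightarrow> \<bar>G (cone_chart w v) - G (cone_chart w (fst v + snd v, 0))\<bar> \<le> \<delta>"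
    and X: "X = (\<lambda>v. (\<bar>indicator S v - g v\<bar> + \<bar>indicator T v - G v\<bar> + 2 * \<delta>) * indicator (annulus 1 5) v)"
    and e: "(\<integral>\<^sup>+v. ennreal (X (cone_chart w v)) * indicator quad v \<partial>plane) < ennreal e"
  shows "\<exists>c. (\<integral>\<^sup>+v. ennreal \<bar>indicator S (cone_chart w v) - c\<bar> * indicator (annulus (11/10) (7/5)) v \<partial>plane) \<le> ennreal (200 * e)
     \<and> (\<integral>\<^sup>+v. ennreal \<bar>indicator T (cone_chart w v) - c\<bar> * indicator (annulus (11/10) (7/5)) v \<partial>plane) \<le> ennreal (200 * e)"
proof (rule nearly_constant_of_profiles[where \<kappa> = "col1 w / col2 w" and
      \<phi> = "\<lambda>\<rho>. g (cone_chart w (\<rho>, 0))" and \<Phi> = "\<lambda>\<rho>. G (cone_chart w (\<rho>, 0))"])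
  note gm [measurable] = continuous_plane_measurable[OF g] continuous_plane_measurable[OF G]
  have [measurable]: "S \<in> sets plane" "T \<in> sets plane"
    using ST by (auto simp: tail_pair_def)
  show "(\<lambda>v. indicator S (cone_chart w v) :: real) \<in> borel_measurable plane"
    "(\<lambda>v. indicator T (cone_chart w v) :: real) \<in> borel_measurable plane"
    by measurable
  show "(\<lambda>\<rho>. g (cone_chart w (\<rho>, 0))) \<in> borel_measurable borel"
    "(\<lambda>\<rho>. G (cone_chart w (\<rho>, 0))) \<in> borel_measurable borel"
    by measurable
  show "1 / 2 \<le> col1 w / col2 w" "col1 w / col2 w \<le> 2"
    using ratio col_pos[of w] by (simp_all add: field_simps)
  show "indicator T (cone_chart w (fst v + col1 w / col2 w * snd v, snd v)) = (indicator S (cone_chart w v) :: real)"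
    if v: "v \<in> quad" for v
  proof -
    have "(fst v / col1 w, snd v / col2 w) \<in> quad"
      using v col_pos[of w] by (simp add: quad_def)
    moreover have "cone_chart w (fst v + col1 w / col2 w * snd v, snd v)
        = word w (letter True (fst v / col1 w, snd v / col2 w))"
      using col_pos[of w] by (simp add: cone_chart_def letter_def add_divide_distrib)
    ultimately show ?thesis
      using ST by (simp add: tail_pair_def cone_chart_def indicator_def)
  qed
  let ?e1 = "\<lambda>v. ennreal \<bar>indicator S (cone_chart w v) - g (cone_chart w (fst v + snd v, 0))\<bar> * indicator (annulus 1 5) v"
  let ?e2 = "\<lambda>v. ennreal \<bar>indicator T (cone_chart w v) - G (cone_chart w (fst v + snd v, 0))\<bar> * indicator (annulus 1 5) v"
  have "(\<integral>\<^sup>+v. ?e1 v \<partial>plane) + (\<integral>\<^sup>+v. ?e2 v \<partial>plane) = (\<integral>\<^sup>+v. ?e1 v + ?e2 v \<partial>plane)"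
    by (rule nn_integral_add[symmetric]) measurable
  also have "\<dots> \<le> (\<integral>\<^sup>+v. ennreal (X (cone_chart w v)) * indicator quad v \<partial>plane)"
  proof (rule nn_integral_mono)
    fix v :: "real \<times> real"
    show "?e1 v + ?e2 v \<le> ennreal (X (cone_chart w v)) * indicator quad v"
    proof (cases "v \<in> annulus 1 5")
      case True
      then have "v \<in> quad" by (simp add: annulus_def)
      have "\<bar>indicator S (cone_chart w v) - g (cone_chart w (fst v + snd v, 0))\<bar>
          + \<bar>indicator T (cone_chart w v) - G (cone_chart w (fst v + snd v, 0))\<bar> \<le> X (cone_chart w v)"
        using narrow[OF True] cone_chart_annulus[OF True, of w] unfolding X by simp
      then show ?thesis
        using True \<open>v \<in> quad\<close> by (simp add: ennreal_plus[symmetric] ennreal_leI del: ennreal_plus)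
    qed simp
  qed
  also note e
  finally show "(\<integral>\<^sup>+v. ?e1 v \<partial>plane) + (\<integral>\<^sup>+v. ?e2 v \<partial>plane) < ennreal e" .
qed

section \<open>Selection of a good cone\<close>

lemma nn_integral_quad_word:
  fixes f :: "real \<times> real \<Rightarrow> real"
  assumes f: "integrable plane f" and nonneg: "\<And>v. 0 \<le> f v"
  shows "(\<integral>\<^sup>+v. ennreal (f (word w v)) * indicator quad v \<partial>plane)
    = ennreal (\<integral>v. indicator quad v * f (word w v) \<partial>plane)"
proof -
  have "(\<integral>\<^sup>+v. ennreal (indicator quad v * f (word w v)) \<partial>plane)
      = ennreal (\<integral>v. indicator quad v * f (word w v) \<partial>plane)"
    by (intro nn_integral_eq_integral integrable_quad integrable_word f) (simp add: nonneg)
  then show ?thesis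
    by (simp add: ennreal_mult' ennreal_indicator mult.commute)
qed

lemma nn_integral_quad_cone_chart:
  fixes f :: "real \<times> real \<Rightarrow> real"
  assumes f: "integrable plane f" and nonneg: "\<And>v. 0 \<le> f v"
  shows "(\<integral>\<^sup>+v. ennreal (f (cone_chart w v)) * indicator quad v \<partial>plane)
    = ennreal (col1 w * col2 w * (\<integral>v. indicator quad v * f (word w v) \<partial>plane))"
    (is "?L = ennreal (?k * ?R)")
proof -
  have k: "0 < ?k" using col_pos[of w] by simp
  have [measurable]: "f \<in> borel_measurable plane" using f by simp
  have "0 \<le> ?R" using nonneg by (intro integral_nonneg_AE) simp
  have "ennreal ?R = ennreal (1 / ?k) * ?L"
    using nn_integral_cone_chart[of "\<lambda>v. ennreal (f v)" w] nn_integral_quad_word[OF assms, of w] by simp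
  then have "ennreal ?k * ennreal ?R = ?L"
    using k col_pos[of w, THEN less_imp_neq, symmetric]
    by (simp add: mult.assoc[symmetric] ennreal_mult[symmetric])
  then show ?thesis using k by (simp add: ennreal_mult')
qed

lemma emeasure_annulus_finite: "emeasure plane (annulus a b) < \<infinity>"
proof -
  have "emeasure plane (annulus a b) \<le> emeasure plane ({0..b} \<times> {0..b})"
    by (intro emeasure_mono) (auto simp: annulus_def quad_def)
  also have "\<dots> = emeasure lborel {0..b} * emeasure lborel {0..b}"
    by (rule lborel.emeasure_pair_measure_Times) auto
  also have "\<dots> < \<infinity>"
    by (simp add: ennreal_mult_less_top emeasure_lborel_Icc_eq)
  finally show ?thesis .
qed

lemma annulus_sets [measurable]: "annulus a b \<in> sets plane"
  using annulus_pred[of a b] unfolding pred_def by (simp add: space_pair_measure)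

text \<open>The error is measured against \<beta>, the mass of Y seen in the chart, rather than
  absolutely. This is exactly what positivity of the integral of \<open>Z\<close> on a cone
  expresses.\<close>

lemma exists_nearly_constant_cone:
  assumes ST: "tail_pair S T"
    and Y: "Y \<in> sets plane" "Y \<subseteq> quad" "0 < emeasure plane Y" "emeasure plane Y < \<infinity>"
    and \<theta>: "\<theta> > 0"
  shows "\<exists>w c \<beta>. 0 < \<beta> \<and> col1 w \<le> 2 * col2 w \<and> col2 w \<le> 2 * col1 w
    \<and> (\<integral>\<^sup>+v. indicator Y (cone_chart w v) * indicator quad v \<partial>plane) = ennreal \<beta>
    \<and> (\<integral>\<^sup>+v. ennreal \<bar>indicator S (cone_chart w v) - c\<bar> * indicator (annulus (11/10) (7/5)) v \<partial>plane) \<le> ennreal (\<theta> * \<beta>)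
    \<and> (\<integral>\<^sup>+v. ennreal \<bar>indicator T (cone_chart w v) - c\<bar> * indicator (annulus (11/10) (7/5)) v \<partial>plane) \<le> ennreal (\<theta> * \<beta>)"
proof -
  define m where "m = measure plane Y"
  define M where "M = measure plane (annulus 1 5)"
  have m2: "emeasure plane Y = ennreal m"
    unfolding m_def using Y(4) by (intro emeasure_eq_ennreal_measure) (simp add: less_top)
  have m: "m > 0" using Y(3) unfolding m2 by simp
  have M: "M \<ge> 0" "emeasure plane (annulus 1 5) = ennreal M"
    unfolding M_def using emeasure_annulus_finite[of 1 5]
    by (simp, intro emeasure_eq_ennreal_measure) (simp add: less_top)
  \<comment> \<open>The integral of \<open>X\<close> will be at most 4 \<epsilon> = \<theta> m /
    400, half of the mass \<theta> m / 200 that it is subtracted from.\<close>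
  define \<epsilon> where "\<epsilon> = \<theta> * m / 1600"
  \<comment> \<open>Makes 2 \<delta> M <= 2 \<epsilon>; the 1 avoids a possible division by
    zero.\<close>
  define \<delta> where "\<delta> = \<epsilon> / (M + 1)"
  have pos: "\<epsilon> > 0" "\<delta> > 0" using \<theta> m M by (simp_all add: \<epsilon>_def \<delta>_def)
  have sets [measurable]: "S \<in> sets plane" "T \<in> sets plane" "Y \<in> sets plane"
    using ST Y by (auto simp: tail_pair_def)
  obtain g :: "real \<times> real \<Rightarrow> real" where g: "continuous_on UNIV g"
      "(\<integral>\<^sup>+v. ennreal \<bar>indicator S v - g v\<bar> \<partial>plane) \<le> ennreal \<epsilon>"
    using indicator_approx_continuous[OF sets(1) pos(1)] by blast
  obtain G :: "real \<times> real \<Rightarrow> real" where G: "continuous_on UNIV G"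
      "(\<integral>\<^sup>+v. ennreal \<bar>indicator T v - G v\<bar> \<partial>plane) \<le> ennreal \<epsilon>"
    using indicator_approx_continuous[OF sets(2) pos(1)] by blast
  note [measurable] = continuous_plane_measurable[OF g(1)] continuous_plane_measurable[OF G(1)]
  define X :: "real \<times> real \<Rightarrow> real" where
    "X = (\<lambda>v. (\<bar>indicator S v - g v\<bar> + \<bar>indicator T v - G v\<bar> + 2 * \<delta>) * indicator (annulus 1 5) v)"
  have X0: "0 \<le> X v" for v using pos by (simp add: X_def)
  have [measurable]: "X \<in> borel_measurable plane" unfolding X_def by measurable
  have "(\<integral>\<^sup>+v. ennreal (X v) \<partial>plane) \<le> (\<integral>\<^sup>+v. ennreal \<bar>indicator S v - g v\<bar> + ennreal \<bar>indicator T v - G v\<bar>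
      + ennreal (2 * \<delta>) * indicator (annulus 1 5) v \<partial>plane)"
    using pos by (intro nn_integral_mono) (auto simp: X_def indicator_def ennreal_plus[symmetric] simp del: ennreal_plus)
  also have "\<dots> = (\<integral>\<^sup>+v. ennreal \<bar>indicator S v - g v\<bar> \<partial>plane) + (\<integral>\<^sup>+v. ennreal \<bar>indicator T v - G v\<bar> \<partial>plane)
      + (\<integral>\<^sup>+v. ennreal (2 * \<delta>) * indicator (annulus 1 5) v \<partial>plane)"
    by (simp add: nn_integral_add)
  also have "(\<integral>\<^sup>+v. ennreal (2 * \<delta>) * indicator (annulus 1 5) v \<partial>plane) = ennreal (2 * \<delta>) * ennreal M"
    unfolding M(2)[symmetric] by (rule nn_integral_cmult_indicator) measurable
  also have "\<dots> = ennreal (2 * (\<delta> * M))"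
    using pos M by (simp add: ennreal_mult[symmetric])
  also have "\<dots> \<le> ennreal (2 * \<epsilon>)"
    using pos M by (intro ennreal_leI) (simp add: \<delta>_def field_simps)
  also have "(\<integral>\<^sup>+v. ennreal \<bar>indicator S v - g v\<bar> \<partial>plane) + (\<integral>\<^sup>+v. ennreal \<bar>indicator T v - G v\<bar> \<partial>plane)
      + ennreal (2 * \<epsilon>) \<le> ennreal \<epsilon> + ennreal \<epsilon> + ennreal (2 * \<epsilon>)"
    by (intro add_mono g G) simp
  also have "\<dots> = ennreal (4 * \<epsilon>)"
    using pos by (simp add: ennreal_plus[symmetric] del: ennreal_plus)
  finally have X_le: "(\<integral>\<^sup>+v. ennreal (X v) \<partial>plane) \<le> ennreal (4 * \<epsilon>)"
    by (simp add: add_left_mono)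
  have iX: "integrable plane X"
    using X_le by (intro integrableI_nonneg) (auto simp: X0 less_top[symmetric] top_unique intro: le_less_trans)
  have "ennreal (\<integral>v. X v \<partial>plane) \<le> ennreal (4 * \<epsilon>)"
    using X_le nn_integral_eq_integral[OF iX] X0 by simp
  then have X_int: "(\<integral>v. X v \<partial>plane) \<le> 4 * \<epsilon>"
    using pos by (simp add: ennreal_le_iff)
  have iY: "integrable plane (indicator Y :: _ \<Rightarrow> real)"
    using Y by (intro integrable_real_indicator) auto
  \<comment> \<open>The 200 cancels the loss in \<open>tail_pair_nearly_constant\<close>.\<close>
  define Z where "Z v = \<theta> / 200 * indicator Y v - X v" for v
  have iZ: "integrable plane Z"
    unfolding Z_def by (intro Bochner_Integration.integrable_diff integrable_mult_right iX iY)
  have "(\<integral>v. indicator quad v * Z v \<partial>plane) = (\<integral>v. Z v \<partial>plane)"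
    using Y(2) by (intro Bochner_Integration.integral_cong) (auto simp: Z_def X_def indicator_def annulus_def)
  also have "\<dots> = \<theta> / 200 * m - (\<integral>v. X v \<partial>plane)"
    unfolding Z_def using iX iY by (simp add: m_def space_pair_measure)
  also have "\<dots> > 0"
    using X_int \<theta> m by (simp add: \<epsilon>_def) (use mult_pos_pos[OF \<theta> m] in linarith)
  finally have Z_pos: "(\<integral>v. indicator quad v * Z v \<partial>plane) > 0" .
  obtain n1 where n1: "\<And>n w v. n \<ge> n1 \<Longrightarrow> 2 ^ Suc n \<le> col1 w \<and> 2 ^ Suc n \<le> col2 w \<Longrightarrow> v \<in> annulus 1 5 \<Longrightarrow>
      \<bar>g (cone_chart w v) - g (cone_chart w (fst v + snd v, 0))\<bar> \<le> \<delta>"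
    using continuous_on_narrow_cones[OF g(1) pos(2)] by blast
  obtain n2 where n2: "\<And>n w v. n \<ge> n2 \<Longrightarrow> 2 ^ Suc n \<le> col1 w \<and> 2 ^ Suc n \<le> col2 w \<Longrightarrow> v \<in> annulus 1 5 \<Longrightarrow>
      \<bar>G (cone_chart w v) - G (cone_chart w (fst v + snd v, 0))\<bar> \<le> \<delta>"
    using continuous_on_narrow_cones[OF G(1) pos(2)] by blast
  obtain w where w: "(\<integral>v. indicator quad v * Z (word w v) \<partial>plane) > 0"
      "2 ^ Suc (max n1 n2) \<le> col1 w \<and> 2 ^ Suc (max n1 n2) \<le> col2 w"
      "col1 w \<le> 2 * col2 w" "col2 w \<le> 2 * col1 w"
    using exists_balanced_word[OF iZ Z_pos, of "max n1 n2"] by blast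
  define IX where "IX = (\<integral>v. indicator quad v * X (word w v) \<partial>plane)"
  define IY where "IY = (\<integral>v. indicator quad v * (indicator Y (word w v) :: real) \<partial>plane)"
  have "(\<integral>v. indicator quad v * Z (word w v) \<partial>plane)
      = (\<integral>v. \<theta> / 200 * (indicator quad v * indicator Y (word w v)) - indicator quad v * X (word w v) \<partial>plane)"
    by (intro Bochner_Integration.integral_cong) (auto simp: Z_def algebra_simps)
  also have "\<dots> = \<theta> / 200 * IY - IX"
    unfolding IX_def IY_def
    by (subst Bochner_Integration.integral_diff)
      (auto intro!: integrable_mult_right integrable_quad integrable_word[OF iX] integrable_word[OF iY])
  finally have less: "IX < \<theta> / 200 * IY" using w(1) by simp
  have "0 \<le> IX" unfolding IX_def using X0 by (intro integral_nonneg_AE) simp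
  then have "0 < \<theta> * IY" using less by linarith
  then have "IY > 0" using \<theta> by (rule zero_less_mult_pos)
  define \<beta> where "\<beta> = col1 w * col2 w * IY"
  have k: "0 < col1 w * col2 w" using col_pos[of w] by simp
  have "\<beta> > 0" using k \<open>IY > 0\<close> by (simp add: \<beta>_def)
  have "(\<integral>\<^sup>+v. ennreal (X (cone_chart w v)) * indicator quad v \<partial>plane) = ennreal (col1 w * col2 w * IX)"
    unfolding IX_def by (rule nn_integral_quad_cone_chart[OF iX X0])
  also have "\<dots> < ennreal (\<theta> / 200 * \<beta>)"
  proof (rule ennreal_lessI)
    show "0 < \<theta> / 200 * \<beta>" using \<theta> \<open>\<beta> > 0\<close> by simp
    show "col1 w * col2 w * IX < \<theta> / 200 * \<beta>"
      using mult_strict_left_mono[OF less k] by (simp add: \<beta>_def mult_ac)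
  qed
  finally have "\<exists>c. (\<integral>\<^sup>+v. ennreal \<bar>indicator S (cone_chart w v) - c\<bar> * indicator (annulus (11/10) (7/5)) v \<partial>plane) \<le> ennreal (200 * (\<theta> / 200 * \<beta>))
     \<and> (\<integral>\<^sup>+v. ennreal \<bar>indicator T (cone_chart w v) - c\<bar> * indicator (annulus (11/10) (7/5)) v \<partial>plane) \<le> ennreal (200 * (\<theta> / 200 * \<beta>))"
    by (intro tail_pair_nearly_constant[OF ST g(1) G(1) w(3,4) _ _ X_def] n1[OF _ w(2)] n2[OF _ w(2)]) auto
  moreover have "(\<integral>\<^sup>+v. indicator Y (cone_chart w v) * indicator quad v \<partial>plane) = ennreal \<beta>"
    using nn_integral_quad_cone_chart[OF iY, of w] by (simp add: \<beta>_def IY_def ennreal_indicator)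
  ultimately show ?thesis
    using w(3,4) \<open>\<beta> > 0\<close> by (intro exI[of _ w]) auto
qed

section \<open>Dilation invariance\<close>

definition scaled :: "real \<Rightarrow> (real \<times> real) set \<Rightarrow> (real \<times> real) set" where
  "scaled c S = {v. (c * fst v, c * snd v) \<in> S}"

lemma scaled_sets [measurable]: "S \<in> sets plane \<Longrightarrow> scaled c S \<in> sets plane"
proof -
  assume [measurable]: "S \<in> sets plane"
  have "Measurable.pred plane (\<lambda>v. (c * fst v, c * snd v) \<in> S)" by measurable
  then show ?thesis by (simp add: pred_def scaled_def space_pair_measure)
qed

lemma AE_plane_scale:
  assumes "AE v in plane. P v" "a > 0" "b > 0"
  shows "AE v in plane. P (a * fst v, b * snd v)"
proof -
  obtain N where N: "{v \<in> space plane. \<not> P v} \<subseteq> N" "emeasure plane N = 0" "N \<in> sets plane"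
    using AE_E[OF assms(1)] by blast
  note [measurable] = N(3)
  have "0 = ennreal (a * b) * (\<integral>\<^sup>+v. indicator N (a * fst v, b * snd v) \<partial>plane)"
    using nn_integral_diagonal_scaling[of "indicator N" a b] assms(2,3) N(2,3) by simp
  then have "(\<integral>\<^sup>+v. indicator N (a * fst v, b * snd v) \<partial>plane) = 0"
    using assms(2,3) by simp
  then have "AE v in plane. (indicator N (a * fst v, b * snd v) :: ennreal) = 0"
    by (subst (asm) nn_integral_0_iff_AE) measurable
  then show ?thesis
    by eventually_elim (use N(1) in \<open>auto simp: space_pair_measure indicator_def split: if_splits\<close>)
qed

lemma scale_quad: "c > 0 \<Longrightarrow> (c * fst v, c * snd v) \<in> quad \<longleftrightarrow> v \<in> quad"
  by (simp add: quad_def zero_less_mult_iff)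

lemma word_scale: "word w (c * fst v, c * snd v) = (c * fst (word w v), c * snd (word w v))"
proof -
  obtain a b p d where "\<And>v. word w v = (a * fst v + b * snd v, p * fst v + d * snd v)"
    using word_matrix[of w] by blast
  then show ?thesis by (simp add: algebra_simps)
qed

lemma letter_scale: "letter b (c * fst v, c * snd v) = (c * fst (letter b v), c * snd (letter b v))"
  using word_scale[of "[b]" c v] by simp

lemma tail_pair_scaled:
  assumes "tail_pair S T" "r > 0"
  shows "tail_pair (scaled r S) (scaled r T)"
  unfolding tail_pair_def
proof (intro conjI allI ballI)
  show "scaled r S \<in> sets plane" "scaled r T \<in> sets plane"
    using assms(1) by (auto simp only: tail_pair_def intro: scaled_sets)
  fix w b v assume "v \<in> quad"
  then have "(r * fst v, r * snd v) \<in> quad" using assms(2) by (simp add: scale_quad)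
  then show "word w (letter b v) \<in> scaled r T \<longleftrightarrow> word w v \<in> scaled r S"
    using assms(1) by (simp add: tail_pair_def scaled_def word_scale[symmetric] letter_scale[symmetric])
qed

text \<open>Otherwise the exceptional set Y has positive measure. On a cone chosen for Y with
  \<theta> = 1/3, wherever the chart hits Y the two indicators differ by 1, so their distances from
  the common constant add up to at least 1. Integration gives \<beta> <= 2/3 \<beta>. Including the
  dilation \<mu> yields both S = T and dilation invariance at once.\<close>

lemma tail_pair_scale_annulus:
  assumes ST: "tail_pair S T" and \<mu>: "1 \<le> \<mu>" "\<mu> \<le> 11 / 10"
  shows "AE v in plane. v \<in> annulus (11/10) (6/5) \<longrightarrow> (v \<in> S \<longleftrightarrow> (\<mu> * fst v, \<mu> * snd v) \<in> T)"
proof -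
  have [measurable]: "S \<in> sets plane" "T \<in> sets plane"
    using ST by (auto simp: tail_pair_def)
  define Y where "Y = {v. v \<in> annulus (11/10) (6/5) \<and> (v \<in> S \<longleftrightarrow> (\<mu> * fst v, \<mu> * snd v) \<notin> T)}"
  have "Measurable.pred plane (\<lambda>v. v \<in> annulus (11/10) (6/5) \<and> (v \<in> S \<longleftrightarrow> (\<mu> * fst v, \<mu> * snd v) \<notin> T))"
    by measurable
  then have Y [measurable]: "Y \<in> sets plane"
    by (simp add: pred_def Y_def space_pair_measure)
  have "Y \<subseteq> quad" by (auto simp: Y_def annulus_def)
  have "emeasure plane Y = 0"
  proof (rule ccontr)
    assume "emeasure plane Y \<noteq> 0"
    then have "0 < emeasure plane Y" by (simp add: zero_less_iff_neq_zero)
    moreover have "emeasure plane Y \<le> emeasure plane (annulus (11/10) (6/5))"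
      by (intro emeasure_mono annulus_sets) (auto simp: Y_def)
    then have "emeasure plane Y < \<infinity>"
      using emeasure_annulus_finite[of "11/10" "6/5"] by (rule le_less_trans)
    ultimately obtain w c \<beta> where \<beta>: "0 < \<beta>"
        "(\<integral>\<^sup>+v. indicator Y (cone_chart w v) * indicator quad v \<partial>plane) = ennreal \<beta>"
      and S: "(\<integral>\<^sup>+v. ennreal \<bar>indicator S (cone_chart w v) - c\<bar> * indicator (annulus (11/10) (7/5)) v \<partial>plane) \<le> ennreal (1/3 * \<beta>)"
      and T: "(\<integral>\<^sup>+v. ennreal \<bar>indicator T (cone_chart w v) - c\<bar> * indicator (annulus (11/10) (7/5)) v \<partial>plane) \<le> ennreal (1/3 * \<beta>)"
      using exists_nearly_constant_cone[OF ST Y \<open>Y \<subseteq> quad\<close>, of "1/3"] by auto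
    let ?S = "\<lambda>v. ennreal \<bar>indicator S (cone_chart w v) - c\<bar> * indicator (annulus (11/10) (7/5)) v"
    let ?T = "\<lambda>v. ennreal \<bar>indicator T (cone_chart w v) - c\<bar> * indicator (annulus (11/10) (7/5)) v"
    \<comment> \<open>Undoing the dilation costs the Jacobian \<mu>^2 >= 1, which only helps the
      upper bound.\<close>
    have one: "1 \<le> ennreal (\<mu> * \<mu>)"
      using \<mu> mult_mono[of 1 \<mu> 1 \<mu>] ennreal_leI[of 1 "\<mu> * \<mu>"] by simp
    have "(\<integral>\<^sup>+v. ?T (\<mu> * fst v, \<mu> * snd v) \<partial>plane) \<le> ennreal (\<mu> * \<mu>) * (\<integral>\<^sup>+v. ?T (\<mu> * fst v, \<mu> * snd v) \<partial>plane)"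
      by (rule mult_right_mono[OF one zero_le, unfolded mult_1])
    also have "\<dots> = (\<integral>\<^sup>+v. ?T v \<partial>plane)"
      using \<mu> by (intro nn_integral_diagonal_scaling[symmetric]) auto
    also note T
    finally have T': "(\<integral>\<^sup>+v. ?T (\<mu> * fst v, \<mu> * snd v) \<partial>plane) \<le> ennreal (1/3 * \<beta>)" .
    have "ennreal \<beta> \<le> (\<integral>\<^sup>+v. ?S v + ?T (\<mu> * fst v, \<mu> * snd v) \<partial>plane)"
      unfolding \<beta>(2)[symmetric]
    proof (rule nn_integral_mono)
      fix v :: "real \<times> real"
      show "indicator Y (cone_chart w v) * indicator quad v \<le> ?S v + ?T (\<mu> * fst v, \<mu> * snd v)"
      proof (cases "v \<in> quad \<and> cone_chart w v \<in> Y")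
        case True
        define r where "r = fst v + snd v"
        have r: "11 / 10 \<le> r" "r < 6 / 5"
          using True norm1_cone_chart[of w v] by (auto simp: Y_def annulus_def r_def)
        \<comment> \<open>Since 6/5 * 11/10 = 33/25 < 7/5, the dilated point stays in the annulus
          where the estimate for T holds.\<close>
        have "1 * r \<le> \<mu> * r" "\<mu> * r \<le> 11 / 10 * r"
          using r \<mu> by (intro mult_right_mono; simp)+
        then have "11 / 10 \<le> \<mu> * r" "\<mu> * r < 7 / 5" using r by linarith+
        then have 1: "v \<in> annulus (11/10) (7/5)" "(\<mu> * fst v, \<mu> * snd v) \<in> annulus (11/10) (7/5)"
          using True r \<mu> scale_quad[of \<mu> v] by (auto simp: annulus_def distrib_left r_def)
        have "\<bar>indicator S (cone_chart w v) - indicator T (cone_chart w (\<mu> * fst v, \<mu> * snd v))\<bar> = (1 :: real)"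
          using True by (auto simp: Y_def cone_chart_scale indicator_def)
        then have "1 \<le> ennreal \<bar>indicator S (cone_chart w v) - c\<bar>
            + ennreal \<bar>c - indicator T (cone_chart w (\<mu> * fst v, \<mu> * snd v))\<bar>"
          using ennreal_abs_triangle[of "indicator S (cone_chart w v)"
              "indicator T (cone_chart w (\<mu> * fst v, \<mu> * snd v))" c] by simp
        then show ?thesis
          using True 1 by (simp add: abs_minus_commute[of c])
      qed (auto simp: indicator_def)
    qed
    also have "\<dots> = (\<integral>\<^sup>+v. ?S v \<partial>plane) + (\<integral>\<^sup>+v. ?T (\<mu> * fst v, \<mu> * snd v) \<partial>plane)"
      by (rule nn_integral_add) measurable
    also have "\<dots> \<le> ennreal (1/3 * \<beta>) + ennreal (1/3 * \<beta>)"
      by (intro add_mono S T')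
    also have "\<dots> = ennreal (2/3 * \<beta>)"
      using \<beta>(1) by (simp add: ennreal_plus[symmetric] del: ennreal_plus)
    finally show False using \<beta>(1) by (simp add: ennreal_le_iff)
  qed
  then have "AE v in plane. v \<notin> Y"
    using Y by (intro AE_not_in) (simp add: null_sets_def)
  then show ?thesis by eventually_elim (auto simp: Y_def)
qed

text \<open>Dilated copies of one annulus with rational factors cover \<open>quad\<close>, and each
  dilated pair is again a tail pair; countability lets the null sets be united.\<close>

lemma tail_pair_scale:
  assumes ST: "tail_pair S T" and \<mu>: "1 \<le> \<mu>" "\<mu> \<le> 11 / 10"
  shows "AE v in plane. v \<in> quad \<longrightarrow> (v \<in> S \<longleftrightarrow> (\<mu> * fst v, \<mu> * snd v) \<in> T)"
proof -
  have "AE v in plane. \<forall>r\<in>{r\<in>\<rat>. 0 < r}. (1 / r * fst v, 1 / r * snd v) \<in> annulus (11/10) (6/5) \<longrightarrow>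
      (v \<in> S \<longleftrightarrow> (\<mu> * fst v, \<mu> * snd v) \<in> T)"
  proof (subst AE_ball_countable)
    show "countable {r \<in> \<rat>. (0 :: real) < r}"
      by (rule countable_subset[OF _ countable_rat]) auto
    show "\<forall>r\<in>{r\<in>\<rat>. 0 < r}. AE v in plane. (1 / r * fst v, 1 / r * snd v) \<in> annulus (11/10) (6/5) \<longrightarrow>
      (v \<in> S \<longleftrightarrow> (\<mu> * fst v, \<mu> * snd v) \<in> T)"
    proof
      fix r :: real assume "r \<in> {r \<in> \<rat>. 0 < r}"
      then have r: "r > 0" by simp
      have "AE v in plane. (1 / r * fst v, 1 / r * snd v) \<in> annulus (11/10) (6/5) \<longrightarrow>
        ((1 / r * fst v, 1 / r * snd v) \<in> scaled r S
          \<longleftrightarrow> (\<mu> * fst (1 / r * fst v, 1 / r * snd v), \<mu> * snd (1 / r * fst v, 1 / r * snd v)) \<in> scaled r T)"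
        using r by (intro AE_plane_scale[OF tail_pair_scale_annulus[OF tail_pair_scaled[OF ST r] \<mu>]]) auto
      then show "AE v in plane. (1 / r * fst v, 1 / r * snd v) \<in> annulus (11/10) (6/5) \<longrightarrow>
          (v \<in> S \<longleftrightarrow> (\<mu> * fst v, \<mu> * snd v) \<in> T)"
        by eventually_elim (use r in \<open>simp add: scaled_def\<close>)
    qed
  qed
  then show ?thesis
  proof eventually_elim
    case (elim v)
    show ?case
    proof
      assume v: "v \<in> quad"
      define \<rho> where "\<rho> = fst v + snd v"
      have "\<rho> > 0" using v by (simp add: \<rho>_def quad_def)
      then have "\<rho> * (5/6) < \<rho> * (10/11)" by simp
      \<comment> \<open>The bounds say that \<rho> / r lies between 11/10 and 6/5.\<close>
      then obtain r where r: "r \<in> \<rat>" "\<rho> * (5/6) < r" "r < \<rho> * (10/11)"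
        using Rats_dense_in_real by blast
      have "r > 0" using r(2) \<open>\<rho> > 0\<close> by (meson less_trans mult_pos_pos zero_less_divide_iff zero_less_numeral)
      have "11 / 10 \<le> 1 / r * fst v + 1 / r * snd v" "1 / r * fst v + 1 / r * snd v < 6 / 5"
        using r \<open>r > 0\<close> by (simp_all add: \<rho>_def field_simps)
      then have "(1 / r * fst v, 1 / r * snd v) \<in> annulus (11/10) (6/5)"
        using v \<open>r > 0\<close> scale_quad[of "1 / r" v] by (simp add: annulus_def)
      then show "v \<in> S \<longleftrightarrow> (\<mu> * fst v, \<mu> * snd v) \<in> T"
        using elim r(1) \<open>r > 0\<close> by blast
    qed
  qed
qed

lemma tail_pair_AE_eq:
  assumes "tail_pair S T"
  shows "AE v in plane. v \<in> quad \<longrightarrow> (v \<in> S \<longleftrightarrow> v \<in> T)"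
  using tail_pair_scale[OF assms, of 1] by simp

text \<open>For \<mu> in [1, 11/10], membership of v in S agrees with that of \<mu> v in T, hence in
  S. Good factors are closed under products, any c >= 1 is a power of an n-th root below 11/10, and
  c < 1 follows by inversion.\<close>

lemma tail_pair_homogeneous:
  assumes ST: "tail_pair S T" and c: "c > 0"
  shows "AE v in plane. v \<in> quad \<longrightarrow> (v \<in> S \<longleftrightarrow> (c * fst v, c * snd v) \<in> S)"
proof -
  define hom where "hom c \<longleftrightarrow> (AE v in plane. v \<in> quad \<longrightarrow> (v \<in> S \<longleftrightarrow> (c * fst v, c * snd v) \<in> S))" for c
  have small: "hom \<mu>" if "1 \<le> \<mu>" "\<mu> \<le> 11 / 10" for \<mu>
  proof -
    have "AE v in plane. (\<mu> * fst v, \<mu> * snd v) \<in> quad \<longrightarrow>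
        ((\<mu> * fst v, \<mu> * snd v) \<in> S \<longleftrightarrow> (\<mu> * fst v, \<mu> * snd v) \<in> T)"
      using that by (intro AE_plane_scale[OF tail_pair_AE_eq[OF ST]]) auto
    with tail_pair_scale[OF ST that] show ?thesis
      unfolding hom_def
      by eventually_elim (use that scale_quad[of \<mu>] in auto)
  qed
  have mult: "hom (a * b)" if "hom a" "hom b" "b > 0" for a b
  proof -
    have "AE v in plane. (b * fst v, b * snd v) \<in> quad \<longrightarrow> ((b * fst v, b * snd v) \<in> S \<longleftrightarrow>
        (a * fst (b * fst v, b * snd v), a * snd (b * fst v, b * snd v)) \<in> S)"
      using that by (intro AE_plane_scale[OF that(1)[unfolded hom_def]]) auto
    with that(2)[unfolded hom_def] show ?thesis
      unfolding hom_def
      by eventually_elim (use that scale_quad[of b] in \<open>auto simp: mult.assoc\<close>)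
  qed
  have power: "hom (a ^ n)" if "hom a" "a > 0" for a n
  proof (induction n)
    case 0
    show ?case by (simp add: hom_def)
  next
    case (Suc n)
    show ?case using mult[OF that(1) Suc.IH] that(2) by simp
  qed
  have large: "hom c" if c: "c \<ge> 1" for c
  proof -
    have "(\<lambda>n. c powr (1 / real n)) \<longlonglongrightarrow> c powr 0"
      using c by (intro tendsto_powr tendsto_const lim_const_over_n) auto
    then have "(\<lambda>n. c powr (1 / real n)) \<longlonglongrightarrow> 1" using c by simp
    then have "eventually (\<lambda>n. c powr (1 / real n) < 11 / 10) sequentially"
      by (rule order_tendstoD) simp
    then obtain n where n: "n > 0" "c powr (1 / real n) < 11 / 10"
      using eventually_conj[OF _ eventually_gt_at_top[of 0]] by (metis (mono_tags, lifting) eventually_sequentially order_refl)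
    have "hom ((c powr (1 / real n)) ^ n)"
      using c n by (intro power small) (auto intro!: ge_one_powr_ge_zero)
    also have "(c powr (1 / real n)) ^ n = c"
      using c n by (simp add: powr_realpow[symmetric] powr_powr)
    finally show ?thesis .
  qed
  have "hom c"
  proof (cases "c \<ge> 1")
    case False
    then have "hom (1 / c)" using c by (intro large) simp
    then have "AE v in plane. (c * fst v, c * snd v) \<in> quad \<longrightarrow> ((c * fst v, c * snd v) \<in> S \<longleftrightarrow>
        (1 / c * fst (c * fst v, c * snd v), 1 / c * snd (c * fst v, c * snd v)) \<in> S)"
      unfolding hom_def using c by (intro AE_plane_scale) auto
    then show ?thesis
      unfolding hom_def by eventually_elim (use c scale_quad[of c] in auto)
  qed (rule large)
  then show ?thesis by (simp add: hom_def)
qed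

text \<open>The tail relation for the empty word gives \<open>letter b v \<in> T\<close> iff
  \<open>v \<in> S\<close>, and S = T almost everywhere. Exceptional sets pull back to null sets
  because words preserve area.\<close>

lemma tail_pair_word:
  assumes ST: "tail_pair S T"
  shows "AE v in plane. v \<in> quad \<longrightarrow> (word w v \<in> S \<longleftrightarrow> v \<in> S)"
proof (induction w)
  case (Cons b w)
  have "AE v in plane. word [b] v \<in> quad \<longrightarrow> (word [b] v \<in> S \<longleftrightarrow> word [b] v \<in> T)"
    by (rule AE_distr_plane[OF distr_word word_measurable tail_pair_AE_eq[OF ST]])
  then have "AE v in plane. v \<in> quad \<longrightarrow> (letter b v \<in> S \<longleftrightarrow> v \<in> S)"
  proof eventually_elim
    case (elim v)
    have "letter b v \<in> T \<longleftrightarrow> v \<in> S" if "v \<in> quad"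
      using ST[unfolded tail_pair_def, THEN conjunct2, THEN conjunct2, rule_format, of v "[]" b] that by simp
    then show ?case using elim letter_quad[of v b] by auto
  qed
  then have "AE v in plane. word w v \<in> quad \<longrightarrow> (letter b (word w v) \<in> S \<longleftrightarrow> word w v \<in> S)"
    by (rule AE_distr_plane[OF distr_word word_measurable])
  with Cons show ?case
    by eventually_elim (auto simp: word_quad)
qed simp

section \<open>Triviality of tail sets\<close>

text \<open>The exceptional null set may depend on the factor \<open>c\<close>.\<close>

definition homogeneous :: "(real \<times> real) set \<Rightarrow> bool" where
  "homogeneous N \<longleftrightarrow> N \<in> sets plane \<and>
     (\<forall>c>0. AE v in plane. v \<in> quad \<longrightarrow> (v \<in> N \<longleftrightarrow> (c * fst v, c * snd v) \<in> N))"

text \<open>Countably many contractions by 1/k suffice, as some k brings any given point into the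
  triangle.\<close>

lemma homogeneous_null_quad:
  assumes N: "homogeneous N" and null: "emeasure plane (N \<inter> annulus 0 r) = 0" and r: "r > 0"
  shows "AE v in plane. v \<in> quad \<longrightarrow> v \<notin> N"
proof -
  have [measurable]: "N \<in> sets plane" using N by (simp add: homogeneous_def)
  have "N \<inter> annulus 0 r \<in> null_sets plane"
    using null by (intro null_setsI sets.Int annulus_sets) measurable
  then have tri: "AE v in plane. v \<notin> N \<inter> annulus 0 r" by (rule AE_not_in)
  have "AE v in plane. \<forall>k :: nat. 0 < k \<longrightarrow> v \<in> quad \<longrightarrow> (1 / real k * fst v, 1 / real k * snd v) \<in> annulus 0 r \<longrightarrow> v \<notin> N"
  proof (subst AE_all_countable, rule allI)
    fix k :: nat
    show "AE v in plane. 0 < k \<longrightarrow> v \<in> quad \<longrightarrow> (1 / real k * fst v, 1 / real k * snd v) \<in> annulus 0 r \<longrightarrow> v \<notin> N"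
    proof (cases "k > 0")
      case True
      then have k: "1 / real k > 0" by simp
      have "AE v in plane. v \<in> quad \<longrightarrow> (v \<in> N \<longleftrightarrow> (1 / real k * fst v, 1 / real k * snd v) \<in> N)"
        using N[unfolded homogeneous_def, THEN conjunct2, rule_format, OF k] .
      with AE_plane_scale[OF tri k k] show ?thesis by eventually_elim auto
    qed simp
  qed
  then show ?thesis
  proof eventually_elim
    case (elim v)
    show ?case
    proof
      assume v: "v \<in> quad"
      obtain k :: nat where "(fst v + snd v) / r < real k"
        using reals_Archimedean2 by blast
      moreover have "0 < (fst v + snd v) / r" using v r by (simp add: quad_def)
      ultimately have k: "k > 0" "(fst v + snd v) / r < real k"
        by (auto intro: gr0I)
      then have "1 / real k * fst v + 1 / real k * snd v < r"
        using r by (simp add: field_simps)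
      then have "(1 / real k * fst v, 1 / real k * snd v) \<in> annulus 0 r"
        using v k scale_quad[of "1 / real k" v] by (auto simp: annulus_def quad_def add_nonneg_nonneg less_imp_le)
      then show "v \<notin> N" using elim v k by blast
    qed
  qed
qed

text \<open>By homogeneity, an annulus carries a fixed proportion of the mass of \<open>N\<close> in the triangle it bounds.\<close>

lemma homogeneous_triangle_bound:
  assumes N: "homogeneous N" and \<kappa>: "1 / 2 \<le> \<kappa>" "\<kappa> \<le> 2" and "0 \<le> x"
    and le: "(\<integral>\<^sup>+v. indicator N (1 / \<kappa> * fst v, 1 * snd v) * indicator (annulus (11/10) (7/5)) v \<partial>plane) \<le> ennreal x"
  shows "emeasure plane (N \<inter> annulus 0 (7/10)) \<le> ennreal (6 * x)"
proof -
  have [measurable]: "N \<in> sets plane" using N by (simp add: homogeneous_def)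
  define D where "D r = (\<integral>\<^sup>+v. indicator N (1 / \<kappa> * fst v, 1 * snd v) * indicator (annulus 0 r) v \<partial>plane)" for r
  have \<kappa>0: "1 / \<kappa> > 0" using \<kappa> by simp
  have finite: "D r < \<infinity>" for r
  proof -
    have "D r \<le> (\<integral>\<^sup>+v. indicator (annulus 0 r) v \<partial>plane)"
      unfolding D_def by (intro nn_integral_mono) (auto simp: indicator_def)
    also have "\<dots> = emeasure plane (annulus 0 r)"
      by (rule nn_integral_indicator[OF annulus_sets])
    finally show ?thesis using emeasure_annulus_finite by (rule le_less_trans)
  qed
  \<comment> \<open>The ratio of 11/10 to 7/5 is 11/14. Homogeneity makes the mass scale like area,
    by 121/196.\<close>
  have "D (11/10) = ennreal (11/14 * (11/14)) * (\<integral>\<^sup>+v. indicator N (1 / \<kappa> * (11/14 * fst v), 1 * (11/14 * snd v))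
      * indicator (annulus 0 (11/10)) (11/14 * fst v, 11/14 * snd v) \<partial>plane)"
    unfolding D_def by (subst nn_integral_diagonal_scaling[of _ "11/14" "11/14"]) auto
  also have "(\<integral>\<^sup>+v. indicator N (1 / \<kappa> * (11/14 * fst v), 1 * (11/14 * snd v))
      * indicator (annulus 0 (11/10)) (11/14 * fst v, 11/14 * snd v) \<partial>plane) = D (7/5)"
    unfolding D_def
  proof (rule nn_integral_cong_AE)
    have "AE v in plane. v \<in> quad \<longrightarrow> (v \<in> N \<longleftrightarrow> (11/14 * fst v, 11/14 * snd v) \<in> N)"
      using N[unfolded homogeneous_def, THEN conjunct2, rule_format, of "11/14"] by simp
    then have "AE v in plane. (1 / \<kappa> * fst v, 1 * snd v) \<in> quad \<longrightarrow> ((1 / \<kappa> * fst v, 1 * snd v) \<in> N \<longleftrightarrow>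
       (11/14 * fst (1 / \<kappa> * fst v, 1 * snd v), 11/14 * snd (1 / \<kappa> * fst v, 1 * snd v)) \<in> N)"
      by (rule AE_plane_scale) (use \<kappa>0 in auto)
    then show "AE v in plane. (indicator N (1 / \<kappa> * (11/14 * fst v), 1 * (11/14 * snd v))
        * indicator (annulus 0 (11/10)) (11/14 * fst v, 11/14 * snd v) :: ennreal)
        = indicator N (1 / \<kappa> * fst v, 1 * snd v) * indicator (annulus 0 (7/5)) v"
    proof eventually_elim
      case (elim v)
      have "(11/14 * fst v, 11/14 * snd v) \<in> annulus 0 (11/10) \<longleftrightarrow> v \<in> annulus 0 (7/5)"
        by (auto simp: annulus_def quad_def)
      moreover have "(1 / \<kappa> * fst v, 1 * snd v) \<in> quad" if "v \<in> annulus 0 (7/5)"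
        using that \<kappa>0 by (simp add: annulus_def quad_def)
      moreover have "(1 / \<kappa> * fst v, 1 * snd v) \<in> quad \<longrightarrow>
          ((1 / \<kappa> * fst v, 1 * snd v) \<in> N \<longleftrightarrow> (1 / \<kappa> * (11/14 * fst v), 1 * (11/14 * snd v)) \<in> N)"
        using elim by (simp add: mult.commute mult.left_commute)
      ultimately show ?case by (auto simp: indicator_def)
    qed
  qed
  finally have D: "D (11/10) = ennreal (121/196) * D (7/5)" by simp
  have "D (7/5) \<le> (\<integral>\<^sup>+v. indicator N (1 / \<kappa> * fst v, 1 * snd v) * indicator (annulus 0 (11/10)) v
      + indicator N (1 / \<kappa> * fst v, 1 * snd v) * indicator (annulus (11/10) (7/5)) v \<partial>plane)"
    unfolding D_def by (intro nn_integral_mono) (auto simp: indicator_def annulus_def)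
  also have "\<dots> = D (11/10) + (\<integral>\<^sup>+v. indicator N (1 / \<kappa> * fst v, 1 * snd v) * indicator (annulus (11/10) (7/5)) v \<partial>plane)"
    unfolding D_def by (rule nn_integral_add) measurable
  also have "\<dots> \<le> ennreal (121/196) * D (7/5) + ennreal x"
    unfolding D by (intro add_left_mono le)
  finally have D': "D (7/5) \<le> ennreal (121/196) * D (7/5) + ennreal x" .
  \<comment> \<open>Finiteness permits absorbing the term 121/196 d; what remains is d <= 196/75 x
    <= 3 x.\<close>
  obtain d where d: "d \<ge> 0" "D (7/5) = ennreal d"
    using finite[of "7/5"] by (cases "D (7/5)") auto
  have "ennreal d \<le> ennreal (121/196 * d + x)"
    using D' d \<open>0 \<le> x\<close> by (simp add: ennreal_mult' ennreal_plus[symmetric] ennreal_mult[symmetric] del: ennreal_plus)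
  then have "d \<le> 121/196 * d + x"
    using d(1) \<open>0 \<le> x\<close> by (subst (asm) ennreal_le_iff) auto
  then have d3: "d \<le> 3 * x" using d(1) \<open>0 \<le> x\<close> by linarith
  have "emeasure plane (N \<inter> annulus 0 (7/10)) = (\<integral>\<^sup>+v. indicator (N \<inter> annulus 0 (7/10)) v \<partial>plane)"
    by (intro nn_integral_indicator[symmetric] sets.Int annulus_sets) measurable
  also have "\<dots> = ennreal (1 / \<kappa> * 1) * (\<integral>\<^sup>+v. indicator (N \<inter> annulus 0 (7/10)) (1 / \<kappa> * fst v, 1 * snd v) \<partial>plane)"
    by (rule nn_integral_diagonal_scaling) (use \<kappa>0 in auto)
  \<comment> \<open>The Jacobian 1/\<kappa> is at most 2. Since \<kappa> <= 2, stretching the first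
    coordinate by \<kappa> keeps the triangle of size 7/10 inside that of size 7/5.\<close>
  also have "\<dots> \<le> ennreal 2 * D (7/5)"
    unfolding D_def
  proof (intro mult_mono ennreal_leI nn_integral_mono)
    show "1 / \<kappa> * 1 \<le> 2" using \<kappa> by (simp add: field_simps)
    fix v :: "real \<times> real"
    show "indicator (N \<inter> annulus 0 (7/10)) (1 / \<kappa> * fst v, 1 * snd v)
      \<le> indicator N (1 / \<kappa> * fst v, 1 * snd v) * (indicator (annulus 0 (7/5)) v :: ennreal)"
    proof (cases "(1 / \<kappa> * fst v, 1 * snd v) \<in> annulus 0 (7/10)")
      case True
      then have v: "0 < fst v" "0 < snd v" "fst v / \<kappa> + snd v < 7/10"
        using \<kappa> by (auto simp: annulus_def quad_def zero_less_divide_iff)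
      have "fst v / 2 \<le> fst v / \<kappa>" using v \<kappa> by (intro divide_left_mono) auto
      then have "v \<in> annulus 0 (7/5)" using v by (simp add: annulus_def quad_def)
      then show ?thesis by (auto simp: indicator_def)
    qed (auto simp: indicator_def)
  qed auto
  also have "\<dots> = ennreal (2 * d)" using d by (simp add: ennreal_mult)
  also have "\<dots> \<le> ennreal (6 * x)" using d3 by (intro ennreal_leI) simp
  finally show ?thesis .
qed

lemma annulus_pos: "0 < emeasure plane (annulus (11/10) (7/5))"
proof -
  have "0 < emeasure lborel {3/5..13/20 :: real} * emeasure lborel {3/5..13/20 :: real}"
    by (simp add: ennreal_zero_less_mult_iff)
  also have "\<dots> = emeasure plane ({3/5..13/20} \<times> {3/5..13/20})"
    by (rule lborel.emeasure_pair_measure_Times[symmetric]) auto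
  also have "\<dots> \<le> emeasure plane (annulus (11/10) (7/5))"
    by (intro emeasure_mono annulus_sets) (auto simp: annulus_def quad_def)
  finally show ?thesis .
qed

text \<open>For every \<theta>, either S or its complement has mass at most 12 \<theta> m in one
  fixed triangle. Which of the two may depend on \<theta>, but both masses are fixed numbers, so one
  of them is 0.\<close>

lemma tail_pair_trivial:
  assumes ST: "tail_pair S T"
  shows "(AE v in plane. v \<in> quad \<longrightarrow> v \<notin> S) \<or> (AE v in plane. v \<in> quad \<longrightarrow> v \<in> S)"
proof -
  have S [measurable]: "S \<in> sets plane" using ST by (simp add: tail_pair_def)
  define R where "R b = {v. v \<in> quad \<and> (v \<in> S \<longleftrightarrow> b)}" for b
  have hom: "homogeneous (R b)" for b
    unfolding homogeneous_def
  proof (intro conjI allI impI)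
    have "Measurable.pred plane (\<lambda>v. v \<in> quad \<and> (v \<in> S \<longleftrightarrow> b))" by measurable
    then show "R b \<in> sets plane" by (simp add: pred_def R_def space_pair_measure)
    fix c :: real assume "c > 0"
    with tail_pair_homogeneous[OF ST this]
    show "AE v in plane. v \<in> quad \<longrightarrow> (v \<in> R b \<longleftrightarrow> (c * fst v, c * snd v) \<in> R b)"
      by (elim eventually_mono) (auto simp: R_def scale_quad)
  qed
  then have [measurable]: "R b \<in> sets plane" for b by (simp add: homogeneous_def)
  define m where "m = measure plane (annulus (11/10) (7/5))"
  have em: "emeasure plane (annulus (11/10) (7/5)) = ennreal m"
    unfolding m_def using emeasure_annulus_finite[of "11/10" "7/5"]
    by (intro emeasure_eq_ennreal_measure) (simp add: less_top)
  have "m > 0" using annulus_pos unfolding em by simp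
  have small: "\<exists>b. emeasure plane (R b \<inter> annulus 0 (7/10)) \<le> ennreal (12 * \<theta> * m)" if \<theta>: "\<theta> > 0" for \<theta>
  proof -
    have Y: "annulus (11/10) (7/5) \<subseteq> quad" by (auto simp: annulus_def)
    obtain w c \<beta> where ratio: "col1 w \<le> 2 * col2 w" "col2 w \<le> 2 * col1 w"
      and \<beta>: "0 < \<beta>" "(\<integral>\<^sup>+v. indicator (annulus (11/10) (7/5)) (cone_chart w v) * indicator quad v \<partial>plane) = ennreal \<beta>"
      and c: "(\<integral>\<^sup>+v. ennreal \<bar>indicator S (cone_chart w v) - c\<bar> * indicator (annulus (11/10) (7/5)) v \<partial>plane) \<le> ennreal (\<theta> * \<beta>)"
      using exists_nearly_constant_cone[OF ST annulus_sets Y annulus_pos emeasure_annulus_finite \<theta>] by blast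
    \<comment> \<open>With Y an annulus, norm preservation of the chart makes \<beta> independent of
      \<open>w\<close>.\<close>
    have "ennreal \<beta> = (\<integral>\<^sup>+v. indicator (annulus (11/10) (7/5)) v \<partial>plane)"
      unfolding \<beta>(2)[symmetric]
    proof (rule nn_integral_cong)
      fix v :: "real \<times> real"
      have "cone_chart w v \<in> annulus (11/10) (7/5) \<and> v \<in> quad \<longleftrightarrow> v \<in> annulus (11/10) (7/5)"
        unfolding annulus_def mem_Collect_eq norm1_cone_chart using cone_chart_quad by blast
      then show "indicator (annulus (11/10) (7/5)) (cone_chart w v) * indicator quad v
          = (indicator (annulus (11/10) (7/5)) v :: ennreal)"
        by (auto simp: indicator_def)
    qed
    also have "\<dots> = ennreal m"
      unfolding em[symmetric] by (rule nn_integral_indicator[OF annulus_sets])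
    finally have "\<beta> = m" using \<beta>(1) \<open>m > 0\<close> by simp
    define \<kappa> where "\<kappa> = col1 w / col2 w"
    have \<kappa>: "1 / 2 \<le> \<kappa>" "\<kappa> \<le> 2"
      using ratio col_pos[of w] by (simp_all add: \<kappa>_def field_simps)
    \<comment> \<open>\<open>R b\<close> is the minority side: on it the indicator of S in the chart
      is at distance at least 1/2 from c.\<close>
    define b where "b \<longleftrightarrow> c < 1 / 2"
    have pos: "1 / col1 w > 0" "1 / col2 w > 0" using col_pos[of w] by auto
    \<comment> \<open>The chart is \<open>word w\<close> after division by the column sums.
      Invariance removes the word, and a dilation by \<open>col2 w\<close> leaves only the stretch
      by 1/\<kappa>.\<close>
    have eq: "AE v in plane. v \<in> quad \<longrightarrow> (cone_chart w v \<in> S \<longleftrightarrow> (1 / \<kappa> * fst v, 1 * snd v) \<in> S)"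
      using AE_plane_scale[OF tail_pair_word[OF ST, of w] pos]
        AE_plane_scale[OF tail_pair_homogeneous[OF ST col_pos(2)[of w]] pos]
    proof eventually_elim
      case (elim v)
      have "(1 / col1 w * fst v, 1 / col2 w * snd v) \<in> quad" if "v \<in> quad"
        using that col_pos[of w] by (simp add: quad_def)
      moreover have "col2 w * (1 / col1 w * fst v) = 1 / \<kappa> * fst v" "col2 w * (1 / col2 w * snd v) = 1 * snd v"
        using col_pos[of w] by (simp_all add: \<kappa>_def)
      ultimately show ?case using elim by (simp add: cone_chart_def)
    qed
    have "(\<integral>\<^sup>+v. indicator (R b) (1 / \<kappa> * fst v, 1 * snd v) * indicator (annulus (11/10) (7/5)) v \<partial>plane)
        \<le> (\<integral>\<^sup>+v. 2 * (ennreal \<bar>indicator S (cone_chart w v) - c\<bar> * indicator (annulus (11/10) (7/5)) v) \<partial>plane)"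
    proof (rule nn_integral_mono_AE)
      show "AE v in plane. indicator (R b) (1 / \<kappa> * fst v, 1 * snd v) * indicator (annulus (11/10) (7/5)) v
          \<le> 2 * (ennreal \<bar>indicator S (cone_chart w v) - c\<bar> * indicator (annulus (11/10) (7/5)) v)"
        using eq
      proof eventually_elim
        case (elim v)
        show ?case
        proof (cases "(1 / \<kappa> * fst v, 1 * snd v) \<in> R b \<and> v \<in> annulus (11/10) (7/5)")
          case True
          then have "cone_chart w v \<in> S \<longleftrightarrow> b" using elim by (auto simp: R_def annulus_def)
          then have "1 \<le> 2 * \<bar>indicator S (cone_chart w v) - c\<bar>" by (auto simp: b_def indicator_def)
          from ennreal_leI[OF this] show ?thesis using True by (simp add: ennreal_mult')
        qed (auto simp: indicator_def)
      qed
    qed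
    also have "\<dots> = 2 * (\<integral>\<^sup>+v. ennreal \<bar>indicator S (cone_chart w v) - c\<bar> * indicator (annulus (11/10) (7/5)) v \<partial>plane)"
      by (rule nn_integral_cmult) measurable
    also have "\<dots> \<le> 2 * ennreal (\<theta> * m)"
      using c unfolding \<open>\<beta> = m\<close> by (intro mult_left_mono) auto
    also have "\<dots> = ennreal (2 * (\<theta> * m))" by (simp add: ennreal_mult')
    finally have "emeasure plane (R b \<inter> annulus 0 (7/10)) \<le> ennreal (6 * (2 * (\<theta> * m)))"
      using \<theta> \<open>m > 0\<close> by (intro homogeneous_triangle_bound[OF hom \<kappa>]) auto
    then show ?thesis by (auto simp: mult_ac)
  qed
  have "\<exists>b. emeasure plane (R b \<inter> annulus 0 (7/10)) = 0"
  proof (rule ccontr)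
    assume "\<not> ?thesis"
    then have nz: "0 < emeasure plane (R b \<inter> annulus 0 (7/10))" for b
      by (auto simp: zero_less_iff_neq_zero)
    \<comment> \<open>Any bound below both masses contradicts \<open>small\<close>, whichever side
      it concerns.\<close>
    define e where "e = min (emeasure plane (R True \<inter> annulus 0 (7/10))) (emeasure plane (R False \<inter> annulus 0 (7/10)))"
    have "0 < e" using nz by (simp add: e_def)
    then obtain y where y: "0 < y" "y < e" using dense by blast
    then obtain d where d: "0 < d" "ennreal d < e" by (cases y) auto
    have "d / (12 * m) > 0" using d \<open>m > 0\<close> by simp
    from small[OF this] obtain b where "emeasure plane (R b \<inter> annulus 0 (7/10)) \<le> ennreal d"
      using \<open>m > 0\<close> by auto
    moreover have "e \<le> emeasure plane (R b \<inter> annulus 0 (7/10))"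
      by (cases b) (auto simp: e_def)
    ultimately show False using d(2) by (meson leD le_less_trans order.trans)
  qed
  then obtain b where "emeasure plane (R b \<inter> annulus 0 (7/10)) = 0" by blast
  from homogeneous_null_quad[OF hom this] have "AE v in plane. v \<in> quad \<longrightarrow> v \<notin> R b" by simp
  then show ?thesis
    by (cases b) (auto simp: R_def elim!: eventually_mono)
qed

section \<open>The Euclidean algorithm\<close>

text \<open>Openness of \<open>quad\<close> matters: for x > 0 the letter \<open>False\<close> sends
  (x, 0) to the diagonal, where \<open>euclid_alg\<close> takes the other branch.\<close>

lemma euclid_alg_letter: "v \<in> quad \<Longrightarrow> euclid_alg (letter b v) = v"
  by (cases v) (auto simp: euclid_alg_def letter_def quad_def)

lemma euclid_alg_power_word:
  "v \<in> quad \<Longrightarrow> (euclid_alg ^^ length w) (word w v) = v"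
proof (induction w)
  case (Cons b w)
  then show ?case
    by (simp add: funpow_swap1[symmetric] funpow_Suc_right euclid_alg_letter word_quad del: funpow.simps)
qed simp

lemma quad_subset_quadrant: "quad \<subseteq> quadrant"
  by (auto simp: quad_def quadrant_def)

lemma quadrant_borel: "quadrant \<in> sets borel"
proof -
  have "Measurable.pred plane (\<lambda>v. 0 \<le> fst v \<and> 0 \<le> snd v)" by measurable
  then have "{v. 0 \<le> fst v \<and> 0 \<le> snd v} \<in> sets plane"
    by (simp add: pred_def space_pair_measure)
  moreover have "quadrant = {v. 0 \<le> fst v \<and> 0 \<le> snd v}" by (auto simp: quadrant_def)
  ultimately show ?thesis unfolding lborel_prod by simp
qed

lemma euclid_alg_measurable [measurable]: "euclid_alg \<in> measurable plane plane"
proof -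
  have eq: "euclid_alg = (\<lambda>v. if snd v \<le> fst v then (fst v - snd v, snd v) else (fst v, snd v - fst v))"
    by (auto simp: euclid_alg_def fun_eq_iff)
  show ?thesis unfolding eq by measurable
qed

lemma space_quadrant_measure: "space quadrant_measure = quadrant"
  by (simp add: quadrant_measure_def space_restrict_space)

lemma sets_quadrant_measure: "A \<in> sets quadrant_measure \<longleftrightarrow> A \<in> sets plane \<and> A \<subseteq> quadrant"
  unfolding quadrant_measure_def lborel_prod
  using quadrant_borel by (subst sets_restrict_space_iff) auto

lemma emeasure_quadrant_measure: "A \<subseteq> quadrant \<Longrightarrow> emeasure quadrant_measure A = emeasure plane A"
  unfolding quadrant_measure_def lborel_prod
  using quadrant_borel by (intro emeasure_restrict_space) auto

lemma euclid_alg_measurable_quadrant: "euclid_alg \<in> measurable quadrant_measure quadrant_measure"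
  unfolding quadrant_measure_def
proof (rule measurable_restrict_space3)
  show "euclid_alg \<in> measurable lborel lborel"
    using euclid_alg_measurable unfolding lborel_prod .
  show "euclid_alg \<in> quadrant \<rightarrow> quadrant"
    by (auto simp: euclid_alg_def quadrant_def)
qed

lemma AE_plane_quad: "AE v in plane. v \<in> quadrant \<longrightarrow> v \<in> quad"
proof -
  have "AE v in plane. fst v \<noteq> 0 \<and> snd v \<noteq> 0"
  proof (rule lborel_pair.AE_pair_measure)
    show "AE x in lborel. AE y in lborel. fst (x :: real, y :: real) \<noteq> 0 \<and> snd (x, y) \<noteq> 0"
      using AE_lborel_singleton[of 0]
    proof eventually_elim
      case (elim x)
      show ?case using AE_lborel_singleton[of 0] by eventually_elim (use elim in auto)
    qed
  qed measurable
  then show ?thesis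
    by eventually_elim (auto simp: quadrant_def quad_def less_le)
qed

text \<open>All words of length m applied to v have v as their m-th image, so a set pulled back
  along m steps cannot distinguish them.\<close>

lemma tail_set_tail_pair:
  assumes tail: "\<And>m. m \<ge> 1 \<Longrightarrow> \<exists>A. \<Omega> = (euclid_alg ^^ m) -` A \<inter> quadrant"
    and \<Omega>: "\<Omega> \<in> sets plane"
  shows "tail_pair \<Omega> (euclid_alg -` \<Omega>)"
  unfolding tail_pair_def
proof (intro conjI allI ballI)
  show "\<Omega> \<in> sets plane" by fact
  show "euclid_alg -` \<Omega> \<in> sets plane"
    using measurable_sets[OF euclid_alg_measurable \<Omega>] by (simp add: space_pair_measure)
  have same_length: "word w v \<in> \<Omega> \<longleftrightarrow> word u v \<in> \<Omega>"
    if "length w = length u" and v: "v \<in> quad" for w u :: "bool list" and v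
  proof (cases "length u = 0")
    case True
    then show ?thesis using that by simp
  next
    case False
    then have "length u \<ge> 1" by linarith
    from tail[OF this] obtain A where "\<Omega> = (euclid_alg ^^ length u) -` A \<inter> quadrant"
      by blast
    then show ?thesis
      using euclid_alg_power_word[OF v, of w] euclid_alg_power_word[OF v, of u] that
        word_quad[OF v, of w] word_quad[OF v, of u] quad_subset_quadrant by auto
  qed
  fix w :: "bool list" and b v assume v: "v \<in> quad"
  \<comment> \<open>\<open>euclid_alg\<close> removes the outermost letter x, not the appended b. It
    leaves u, which has the length of \<open>w\<close> but need not equal it.\<close>
  obtain x u where xu: "w @ [b] = x # u" by (cases "w @ [b]") auto
  then have "length w = length u" by (metis length_append_singleton length_Cons nat.inject)
  have "word w (letter b v) = word (w @ [b]) v" by simp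
  also have "\<dots> = letter x (word u v)" unfolding xu by simp
  finally have "euclid_alg (word w (letter b v)) = word u v"
    using v by (simp add: euclid_alg_letter word_quad)
  then show "word w (letter b v) \<in> euclid_alg -` \<Omega> \<longleftrightarrow> word w v \<in> \<Omega>"
    using same_length[OF \<open>length w = length u\<close> v] by simp
qed

theorem theorem1p1:
  shows "exact_map quadrant_measure euclid_alg"
  unfolding exact_map_def
proof (intro conjI ballI)
  show "euclid_alg \<in> measurable quadrant_measure quadrant_measure"
    by (rule euclid_alg_measurable_quadrant)
  fix \<Omega>
  assume *: "\<Omega> \<in> (\<Inter>m\<in>{1::nat..}. {(euclid_alg ^^ m) -` A \<inter> space quadrant_measure |A. A \<in> sets quadrant_measure})"
  have tail: "\<exists>A. A \<in> sets quadrant_measure \<and> \<Omega> = (euclid_alg ^^ m) -` A \<inter> quadrant" if "m \<ge> 1" for m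
  proof -
    have "\<Omega> \<in> {(euclid_alg ^^ m) -` A \<inter> quadrant |A. A \<in> sets quadrant_measure}"
      using INT_D[OF *, of m] that by (simp only: atLeast_iff space_quadrant_measure)
    then show ?thesis by blast
  qed
  \<comment> \<open>The case m = 1 yields measurability of the tail set itself.\<close>
  obtain A where "A \<in> sets quadrant_measure" "\<Omega> = (euclid_alg ^^ 1) -` A \<inter> space quadrant_measure"
    using tail[of 1] unfolding space_quadrant_measure by blast
  then have "\<Omega> \<in> sets quadrant_measure"
    using measurable_sets[OF euclid_alg_measurable_quadrant] by simp
  then have \<Omega>: "\<Omega> \<in> sets plane" "\<Omega> \<subseteq> quadrant"
    by (simp_all only: sets_quadrant_measure)
  have quadrant: "quadrant \<in> sets plane"
    using quadrant_borel unfolding lborel_prod by simp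
  have "tail_pair \<Omega> (euclid_alg -` \<Omega>)"
    using tail by (intro tail_set_tail_pair \<Omega>) blast
  then consider "AE v in plane. v \<in> quad \<longrightarrow> v \<notin> \<Omega>" | "AE v in plane. v \<in> quad \<longrightarrow> v \<in> \<Omega>"
    using tail_pair_trivial by blast
  then show "emeasure quadrant_measure \<Omega> = 0 \<or> emeasure quadrant_measure (space quadrant_measure - \<Omega>) = 0"
  proof cases
    case 1
    with AE_plane_quad have "AE v in plane. v \<notin> \<Omega>"
      by eventually_elim (use \<Omega>(2) in blast)
    then have "emeasure plane \<Omega> = 0"
      using AE_iff_null_sets[OF \<Omega>(1)] by blast
    then show ?thesis using emeasure_quadrant_measure[OF \<Omega>(2)] by simp
  next
    case 2
    with AE_plane_quad have "AE v in plane. v \<notin> quadrant - \<Omega>"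
      by eventually_elim blast
    then have "emeasure plane (quadrant - \<Omega>) = 0"
      using AE_iff_null_sets[OF sets.Diff[OF quadrant \<Omega>(1)]] by blast
    then show ?thesis
      using emeasure_quadrant_measure[of "quadrant - \<Omega>"] by (simp add: space_quadrant_measure)
  qed
qed

end
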